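(* Let $t$ be a positive integer and let $\mathcal{M}$ be a family of Boolean matrices none of which contains a $t\times t$ all-ones submatrix. Then the following are equivalent. (1) There exists $\gamma$ such that $\gamma_2(M)\le\gamma$ for every $M\in\mathcal{M}$. (2) There exists $b$ such that every $M\in\mathcal{M}$ is the sum of at most $b$ thin blocky matrices. (3) There exists $d$ such that every $M\in\mathcal{M}$ has degeneracy at most $d$.
   Context: A Boolean matrix is a matrix with entries in $\{0,1\}$. A submatrix is obtained by choosing an arbitrary subset of the rows and an arbitrary subset of the columns. For a real matrix $M$, $\gamma_2(M)=\min_{UV=M}\|U\|_{\mathrm{row}}\|V\|_{\mathrm{col}}$, where the minimum is over all factorizations $M=UV$ into real matrices, $\|U\|_{\mathrm{row}}$ is the maximum $\ell_2$-norm of a row of $U$, and $\|V\|_{\mathrm{col}}$ is the maximum $\ell_2$-norm of a column of $V$. A blocky matrix is a Boolean matrix $M$ whose rows and columns can be partitioned into (possibly empty for index $0$) sets $A_0,A_1,\dots,A_k$ and $B_0,B_1,\dots,B_k$, for some $k\ge 0$, such that $M[A_i\times B_i]$ is an all-ones matrix for $i=1,\dots,k$, and $M[A_i\times B_j]=0$ whenever $i\ne j$ or $i=j=0$. It is thin if for every $i=1,\dots,k$ either $|A_i|=1$ or $|B_i|=1$. The degeneracy of a Boolean matrix $M$ is the smallest nonnegative integer $d$ such that every submatrix of $M$ has a row or a column with at most $d$ one entries. *)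

theory Defs
  imports Complex_Main "HOL-Library.Disjoint_Sets" "Jordan_Normal_Form.DL_Submatrix"
begin

definition boolean_mat :: "real mat \<Rightarrow> bool" where
  "boolean_mat M \<longleftrightarrow> elements_mat M \<subseteq> {0, 1}"

definition vec_l2_norm :: "real vec \<Rightarrow> real" where
  "vec_l2_norm v = sqrt (scalar_prod v v)"

text \<open>Norms are nonnegative, so inserting 0 only fixes the value for matrices without rows,
  respectively without columns.\<close>

definition row_norm :: "real mat \<Rightarrow> real" where
  "row_norm U = Max (insert 0 (vec_l2_norm ` set (rows U)))"

definition col_norm :: "real mat \<Rightarrow> real" where
  "col_norm V = Max (insert 0 (vec_l2_norm ` set (cols V)))"

text \<open>The inner dimension \<open>k\<close> ranges over all natural numbers. The set is nonempty
  (take \<open>V\<close> to be the identity) and bounded below by 0, and by a compactness argument its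
  infimum is attained, so \<open>Inf\<close> is the minimum.\<close>

definition gamma2 :: "real mat \<Rightarrow> real" where
  "gamma2 M = Inf {row_norm U * col_norm V | U V k.
     U \<in> carrier_mat (dim_row M) k \<and> V \<in> carrier_mat k (dim_col M) \<and> U * V = M}"

definition contains_all_ones :: "real mat \<Rightarrow> nat \<Rightarrow> bool" where
  "contains_all_ones M t \<longleftrightarrow> (\<exists>I J. submatrix M I J = mat t t (\<lambda>_. 1))"

text \<open>Only the parts with index 0 may be empty.\<close>

definition blocky_partition ::
    "real mat \<Rightarrow> nat \<Rightarrow> (nat \<Rightarrow> nat set) \<Rightarrow> (nat \<Rightarrow> nat set) \<Rightarrow> bool" where
  "blocky_partition M k A B \<longleftrightarrow>
     disjoint_family_on A {0..k} \<and> (\<Union>i\<in>{0..k}. A i) = {0..<dim_row M} \<and>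
     disjoint_family_on B {0..k} \<and> (\<Union>i\<in>{0..k}. B i) = {0..<dim_col M} \<and>
     (\<forall>i\<in>{1..k}. A i \<noteq> {} \<and> B i \<noteq> {}) \<and>
     (\<forall>i\<in>{1..k}. \<forall>r\<in>A i. \<forall>c\<in>B i. M $$ (r, c) = 1) \<and>
     (\<forall>i\<in>{0..k}. \<forall>j\<in>{0..k}. i \<noteq> j \<or> (i = 0 \<and> j = 0) \<longrightarrow>
        (\<forall>r\<in>A i. \<forall>c\<in>B j. M $$ (r, c) = 0))"

definition blocky :: "real mat \<Rightarrow> bool" where
  "blocky M \<longleftrightarrow> boolean_mat M \<and> (\<exists>k A B. blocky_partition M k A B)"

text \<open>The blocks with index at least 1 are determined by the matrix up to reordering, so it does
  not matter that the partition is quantified existentially here.\<close>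

definition thin_blocky :: "real mat \<Rightarrow> bool" where
  "thin_blocky M \<longleftrightarrow> boolean_mat M \<and>
     (\<exists>k A B. blocky_partition M k A B \<and> (\<forall>i\<in>{1..k}. card (A i) = 1 \<or> card (B i) = 1))"

text \<open>The \<open>0 \<times> 0\<close> submatrix, which has neither a row nor a column, is excluded.\<close>

definition degenerate_within :: "real mat \<Rightarrow> nat \<Rightarrow> bool" where
  "degenerate_within M d \<longleftrightarrow> (\<forall>I J. let S = submatrix M I J in
     dim_row S > 0 \<or> dim_col S > 0 \<longrightarrow>
     (\<exists>i<dim_row S. card {j. j < dim_col S \<and> S $$ (i, j) = 1} \<le> d) \<or>
     (\<exists>j<dim_col S. card {i. i < dim_row S \<and> S $$ (i, j) = 1} \<le> d))"

definition degeneracy :: "real mat \<Rightarrow> nat" where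
  "degeneracy M = (LEAST d. degenerate_within M d)"

lemma degenerate_within_dim_col: "degenerate_within M (dim_col M)"
proof -
  have bd: "card {j. j < dim_col (submatrix M I J) \<and> P j} \<le> dim_col M" for I J P
  proof -
    have "card {j. j < dim_col (submatrix M I J) \<and> P j} \<le> card {..<dim_col (submatrix M I J)}"
      by (intro card_mono) auto
    also have "\<dots> = card {j. j < dim_col M \<and> j \<in> J}"
      by (simp add: dim_submatrix)
    also have "\<dots> \<le> card {..<dim_col M}"
      by (intro card_mono) auto
    finally show ?thesis by simp
  qed
  show ?thesis
    unfolding degenerate_within_def Let_def
  proof (intro allI impI)
    fix I J
    assume ne: "dim_row (submatrix M I J) > 0 \<or> dim_col (submatrix M I J) > 0"
    show "(\<exists>i<dim_row (submatrix M I J). card {j. j < dim_col (submatrix M I J) \<and>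
             submatrix M I J $$ (i, j) = 1} \<le> dim_col M) \<or>
          (\<exists>j<dim_col (submatrix M I J). card {i. i < dim_row (submatrix M I J) \<and>
             submatrix M I J $$ (i, j) = 1} \<le> dim_col M)"
    proof (cases "dim_row (submatrix M I J) = 0")
      case True
      then have "dim_col (submatrix M I J) > 0" using ne by simp
      then show ?thesis using True by (intro disjI2 exI[of _ 0]) simp
    next
      case False
      then show ?thesis using bd by (intro disjI1 exI[of _ 0]) simp
    qed
  qed
qed

lemma degenerate_within_degeneracy: "degenerate_within M (degeneracy M)"
  unfolding degeneracy_def by (rule LeastI) (rule degenerate_within_dim_col)

end

theory Submission
  imports Defs "Jordan_Normal_Form.Determinant"
begin

text \<open>Bounded degeneracy gives thin blocky matrices by removing rows and columns one at a time: the
  at most \<open>d\<close> ones of the removed row (column) receive distinct colours out of \<open>d\<close> colours reserved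
  for rows (columns), and every colour class is thin blocky. A blocky matrix factors through the
  indicator vectors of its blocks, and concatenating such factorizations bounds \<open>\<gamma>\<^sub>2\<close> of a sum.

  The main point is that bounded \<open>\<gamma>\<^sub>2\<close> without large all-ones submatrices forces bounded degeneracy.
  For a Boolean matrix with \<open>n\<close> rows, column degrees \<open>e y\<close> and \<open>m\<close> ones, \<open>\<gamma>\<^sub>2\<close> duality yields
  \<open>m\<^sup>2 \<le> \<gamma>\<^sub>2\<^sup>2 * n * Q\<close>, where \<open>Q\<close> sums the squared codegree of \<open>y\<close> and \<open>z\<close> divided by \<open>e z\<close>; the
  dual witness is a resolvent of the normalized matrix. If the degeneracy is large, pass to a
  submatrix maximizing the ratio \<open>\<rho>\<close> of the number of ones to the number of rows and columns
  together, transpose it so that it has at least as many rows as columns, and drop the few rows of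
  degree above \<open>4 * \<rho>\<close>. Then the inequality can only hold if for some entry \<open>(x, z)\<close> the submatrix
  of the neighbours of \<open>z\<close> and the neighbours of \<open>x\<close> has density bounded below, and a large dense
  Boolean matrix contains a \<open>t \<times> t\<close> all-ones submatrix by the pigeonhole principle.\<close>

section \<open>All-ones submatrices of dense matrices\<close>

text \<open>In the combinatorial part matrices are functions on index sets, so that passing to a
  submatrix means passing to subsets and transposing means swapping the arguments, with no
  renumbering.\<close>

definition has_all_ones :: "nat \<Rightarrow> 'a set \<Rightarrow> 'b set \<Rightarrow> ('a \<Rightarrow> 'b \<Rightarrow> real) \<Rightarrow> bool" where
  "has_all_ones t X Y a \<longleftrightarrow>
     (\<exists>S T. S \<subseteq> X \<and> T \<subseteq> Y \<and> card S = t \<and> card T = t \<and> (\<forall>x\<in>S. \<forall>y\<in>T. a x y = 1))"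

lemma has_all_ones_mono:
  assumes "has_all_ones t X Y a" "X \<subseteq> X'" "Y \<subseteq> Y'"
  shows "has_all_ones t X' Y' a"
proof -
  obtain S T where "S \<subseteq> X" "T \<subseteq> Y" "card S = t" "card T = t" "\<forall>x\<in>S. \<forall>y\<in>T. a x y = 1"
    using assms(1) unfolding has_all_ones_def by (elim exE conjE)
  moreover have "S \<subseteq> X'" "T \<subseteq> Y'" using calculation(1,2) assms(2,3) by blast+
  ultimately show ?thesis unfolding has_all_ones_def by (intro exI conjI)
qed

lemma has_all_ones_transpose:
  "has_all_ones t Y X (\<lambda>y x. a x y) \<longleftrightarrow> has_all_ones t X Y a"
  unfolding has_all_ones_def by blast

text \<open>Two rounds of averaging produce many rows that each have at least \<open>t\<close> ones
  inside a fixed set of \<open>q\<close> columns. These rows have at most \<open>2 ^ q\<close>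
  different traces on the \<open>q\<close> columns, so \<open>t\<close> of them share one trace, and
  it contains \<open>t\<close> columns. \<open>N\<close> depends only on \<delta> and
  \<open>t\<close>.\<close>

lemma dense_contains_all_ones:
  fixes \<delta> :: real and t :: nat
  assumes "\<delta> > 0" "t > 0"
  obtains N :: nat where
    "\<And>(P :: 'a set) (Q :: 'b set) a. finite P \<Longrightarrow> finite Q \<Longrightarrow> N \<le> card P \<Longrightarrow> N \<le> card Q \<Longrightarrow>
       (\<And>x y. x \<in> P \<Longrightarrow> y \<in> Q \<Longrightarrow> a x y \<in> {0, 1 :: real}) \<Longrightarrow>
       \<delta> * card P * card Q < (\<Sum>x\<in>P. \<Sum>y\<in>Q. a x y) \<Longrightarrow>
       has_all_ones t P Q a"
proof -
  \<comment> \<open>A column called heavy below has at least \<open>\<delta> / 2 * card P\<close>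
    ones, so \<open>q\<close> heavy columns hold at least \<open>2 * t * card P\<close> ones: on
    average \<open>2 * t\<close> per row.\<close>
  define q where "q = nat \<lceil>4 * real t / \<delta>\<rceil>"
  have "4 * real t / \<delta> \<le> real q" unfolding q_def by linarith
  then have q: "4 * real t \<le> \<delta> * real q" using assms by (simp add: field_simps)
  then have q_pos: "q > 0" using assms by (cases q) auto
  \<comment> \<open>The first bound provides the \<open>t * 2 ^ q\<close> rows for the pigeonhole
    principle, the second provides \<open>q\<close> heavy columns.\<close>
  define N where "N = max (q * 2 ^ q) (nat \<lceil>2 * real q / \<delta>\<rceil>)"
  have "2 * real q / \<delta> \<le> real N" unfolding N_def by linarith
  then have N1: "2 * real q \<le> \<delta> * real N" using assms by (simp add: field_simps)
  have N2: "q * 2 ^ q \<le> N" unfolding N_def by simp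
  show ?thesis
  proof (rule that[of N])
    fix P :: "'a set" and Q :: "'b set" and a :: "'a \<Rightarrow> 'b \<Rightarrow> real"
    assume fin: "finite P" "finite Q" and NP: "N \<le> card P" and NQ: "N \<le> card Q"
      and a01: "\<And>x y. x \<in> P \<Longrightarrow> y \<in> Q \<Longrightarrow> a x y \<in> {0, 1}"
      and dense: "\<delta> * card P * card Q < (\<Sum>x\<in>P. \<Sum>y\<in>Q. a x y)"
    have a_le: "a x y \<le> 1" and a_ge: "0 \<le> a x y" if "x \<in> P" "y \<in> Q" for x y
      using a01[OF that] by auto
    have P_pos: "card P > 0" using N2 NP q_pos by (metis le_zero_eq mult_is_0 not_gr_zero power_not_zero zero_neq_numeral)
    \<comment> \<open>The light columns account for at most
      \<open>\<delta> / 2 * card P * card Q\<close> ones, so more than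
      \<open>\<delta> / 2 * card Q\<close> columns are heavy.\<close>
    define H where "H = {y \<in> Q. \<delta> / 2 * card P \<le> (\<Sum>x\<in>P. a x y)}"
    have "H \<subseteq> Q" "finite H" using fin by (auto simp: H_def)
    have "\<delta> * card P * card Q < (\<Sum>y\<in>Q. \<Sum>x\<in>P. a x y)"
      using dense by (subst sum.swap)
    also have "\<dots> \<le> (\<Sum>y\<in>Q. of_bool (y \<in> H) * real (card P) + \<delta> / 2 * card P)"
    proof (rule sum_mono)
      fix y assume y: "y \<in> Q"
      have "(\<Sum>x\<in>P. a x y) \<le> (\<Sum>x\<in>P. 1)" using a_le y by (intro sum_mono) auto
      then show "(\<Sum>x\<in>P. a x y) \<le> of_bool (y \<in> H) * real (card P) + \<delta> / 2 * card P"
        using y assms(1) by (cases "y \<in> H") (auto simp: H_def intro: add_increasing2)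
    qed
    also have "\<dots> = real (card H) * card P + card Q * (\<delta> / 2 * card P)"
      using \<open>H \<subseteq> Q\<close> fin by (simp add: sum.distrib flip: sum_distrib_right) (simp add: Int_absorb1)
    finally have "(\<delta> / 2 * card Q) * card P < card H * real (card P)" by (simp add: field_simps)
    then have "\<delta> / 2 * card Q < card H" using P_pos by simp
    moreover have "\<delta> * real N \<le> \<delta> * card Q" using NQ assms(1) by simp
    ultimately have "q \<le> card H" using N1 by linarith
    then obtain Q0 where Q0: "Q0 \<subseteq> H" "card Q0 = q" "finite Q0"
      by (meson \<open>finite H\<close> finite_subset obtain_subset_with_card_n)
    have Q0Q: "Q0 \<subseteq> Q" using Q0 \<open>H \<subseteq> Q\<close> by blast
    \<comment> \<open>Rows outside \<open>G\<close> contribute at most \<open>t\<close>, half of the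
      average \<open>2 * t\<close>. The other half must come from \<open>G\<close>, whose rows
      contribute at most \<open>q\<close> each.\<close>
    define G where "G = {x \<in> P. real t \<le> (\<Sum>y\<in>Q0. a x y)}"
    have G: "G \<subseteq> P" "finite G" using fin by (auto simp: G_def)
    have "2 * real t * card P \<le> real q * (\<delta> / 2 * card P)"
      using mult_right_mono[OF q, of "real (card P) / 2"] by (simp add: field_simps)
    also have "\<dots> = (\<Sum>y\<in>Q0. \<delta> / 2 * card P)" using Q0 by simp
    also have "\<dots> \<le> (\<Sum>y\<in>Q0. \<Sum>x\<in>P. a x y)"
      using Q0 by (intro sum_mono) (auto simp: H_def)
    also have "\<dots> = (\<Sum>x\<in>P. \<Sum>y\<in>Q0. a x y)" by (rule sum.swap)
    also have "\<dots> \<le> (\<Sum>x\<in>P. of_bool (x \<in> G) * real q + real t)"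
    proof (rule sum_mono)
      fix x assume x: "x \<in> P"
      have "(\<Sum>y\<in>Q0. a x y) \<le> (\<Sum>y\<in>Q0. 1)" using a_le x Q0Q by (intro sum_mono) auto
      then show "(\<Sum>y\<in>Q0. a x y) \<le> of_bool (x \<in> G) * real q + real t"
        using x Q0 by (cases "x \<in> G") (auto simp: G_def)
    qed
    also have "\<dots> = card G * real q + card P * real t"
      using G fin by (simp add: sum.distrib flip: sum_distrib_right) (simp add: Int_absorb1)
    finally have "real t * card P \<le> card G * real q" by (simp add: algebra_simps)
    then have tP: "t * card P \<le> card G * q" by (metis of_nat_le_iff of_nat_mult)
    have "t * (q * 2 ^ q) \<le> t * card P" using N2 NP by (meson le_trans mult_le_mono2)
    then have "t * (q * 2 ^ q) \<le> card G * q" using tP by (rule order_trans)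
    moreover have "t * (q * 2 ^ q) = (t * 2 ^ q) * q" by simp
    ultimately have "(t * 2 ^ q) * q \<le> card G * q" by metis
    then have cG: "t * 2 ^ q \<le> card G" using q_pos by simp
    define f where "f x = {y \<in> Q0. a x y = 1}" for x
    have "\<exists>T\<in>Pow Q0. t \<le> card {x \<in> G. f x = T}"
    proof (rule ccontr)
      assume none: "\<not> ?thesis"
      have small: "card {x \<in> G. f x = T} \<le> t - 1" if "T \<in> Pow Q0" for T
      proof -
        have "\<not> t \<le> card {x \<in> G. f x = T}" using none that by blast
        then show ?thesis by linarith
      qed
      have "f x \<in> Pow Q0" for x by (auto simp: f_def)
      then have "card G = card (\<Union>T\<in>Pow Q0. {x \<in> G. f x = T})" by (intro arg_cong[of _ _ card]) blast
      also have "\<dots> \<le> (\<Sum>T\<in>Pow Q0. card {x \<in> G. f x = T})"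
        using Q0 by (intro card_UN_le) simp
      also have "\<dots> \<le> (\<Sum>T\<in>Pow Q0. t - 1)" using small by (rule sum_mono)
      also have "\<dots> = 2 ^ q * (t - 1)" using Q0 by (simp add: card_Pow)
      also have "\<dots> < 2 ^ q * t" using assms by simp
      finally show False using cG by (simp add: mult.commute)
    qed
    then obtain T0 where T0: "T0 \<subseteq> Q0" "t \<le> card {x \<in> G. f x = T0}" by blast
    obtain S where S: "S \<subseteq> {x \<in> G. f x = T0}" "card S = t" "finite S"
      using obtain_subset_with_card_n[OF T0(2)] by blast
    \<comment> \<open>A row of \<open>G\<close> with trace \<open>T0\<close> shows that
      \<open>T0\<close> has at least \<open>t\<close> elements; such a row exists because
      \<open>t > 0\<close>.\<close>
    obtain x where "x \<in> S" using S assms(2) by (metis card_gt_0_iff ex_in_conv)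
    then have x: "x \<in> G" "f x = T0" using S by auto
    have "real t \<le> (\<Sum>y\<in>Q0. a x y)" using x by (simp add: G_def)
    also have "\<dots> = (\<Sum>y\<in>Q0. of_bool (y \<in> T0))"
      using x G a01 Q0Q by (intro sum.cong) (auto simp: f_def)
    also have "\<dots> = card T0" using T0 Q0 by (simp add: Int_absorb1)
    finally have "t \<le> card T0" by simp
    then obtain T where T: "T \<subseteq> T0" "card T = t"
      by (meson obtain_subset_with_card_n)
    have "\<forall>x\<in>S. \<forall>y\<in>T. a x y = 1" using S T by (auto simp: f_def)
    then show "has_all_ones t P Q a"
      unfolding has_all_ones_def using S T T0 G Q0Q by (intro exI[of _ S] exI[of _ T]) auto
  qed
qed

section \<open>A codegree inequality for factored matrices\<close>

text \<open>In finite dimension a trivial kernel gives solvability. The system is carried over to a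
  matrix along an enumeration of \<open>Y\<close>, where the trivial kernel becomes a nonzero
  determinant. This serves to invert \<open>1 + l * R\<close> below.\<close>

lemma square_linear_system_solvable:
  fixes L :: "'a \<Rightarrow> 'a \<Rightarrow> real"
  assumes fin: "finite Y"
    and inj: "\<And>f. (\<forall>y\<in>Y. (\<Sum>z\<in>Y. L y z * f z) = 0) \<Longrightarrow> (\<forall>y\<in>Y. f y = 0)"
  shows "\<exists>f. \<forall>y\<in>Y. (\<Sum>z\<in>Y. L y z * f z) = g y"
proof -
  define n where "n = card Y"
  obtain h where h: "bij_betw h {..<n} Y"
    using ex_bij_betw_nat_finite[OF fin] by (auto simp: n_def atLeast0LessThan)
  define h' where "h' = the_inv_into {..<n} h"
  have h'h: "h' (h i) = i" if "i < n" for i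
    using h that unfolding h'_def by (simp add: bij_betw_def the_inv_into_f_f)
  have hY: "h i \<in> Y" if "i < n" for i using h that by (auto simp: bij_betw_def)
  have Yh: "\<exists>i<n. y = h i" if "y \<in> Y" for y using h that by (auto simp: bij_betw_def)
  define A where "A = mat n n (\<lambda>(i, j). L (h i) (h j))"
  have A: "A \<in> carrier_mat n n" by (simp add: A_def)
  have Av: "(A *\<^sub>v w) $ i = (\<Sum>z\<in>Y. L (h i) z * w $ h' z)"
    if "i < n" "w \<in> carrier_vec n" for w i
  proof -
    have "(A *\<^sub>v w) $ i = (\<Sum>j<n. L (h i) (h j) * w $ h' (h j))"
      using that by (simp add: A_def scalar_prod_def h'h atLeast0LessThan)
    also have "\<dots> = (\<Sum>z\<in>Y. L (h i) z * w $ h' z)"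
      by (rule sum.reindex_bij_betw[OF h])
    finally show ?thesis .
  qed
  have "det A \<noteq> 0"
  proof
    assume "det A = 0"
    then obtain w where w: "w \<in> carrier_vec n" "w \<noteq> 0\<^sub>v n" "A *\<^sub>v w = 0\<^sub>v n"
      using det_0_iff_vec_prod_zero_field[OF A] by blast
    have "(\<Sum>z\<in>Y. L y z * w $ h' z) = 0" if "y \<in> Y" for y
    proof -
      obtain i where i: "i < n" "y = h i" using Yh \<open>y \<in> Y\<close> by blast
      then show ?thesis using Av[of i w] w by simp
    qed
    then have "\<forall>y\<in>Y. w $ h' y = 0" using inj[of "\<lambda>z. w $ h' z"] by simp
    then have "w $ i = 0" if "i < n" for i using hY[OF that] h'h[OF that] by force
    then show False using w by (metis carrier_vecD eq_vecI index_zero_vec)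
  qed
  define gv where "gv = vec n (\<lambda>i. g (h i))"
  \<comment> \<open>Cramer's rule: the adjugate divided by the determinant inverts
    \<open>A\<close>.\<close>
  define w where "w = (1 / det A) \<cdot>\<^sub>v (adj_mat A *\<^sub>v gv)"
  have adj: "adj_mat A \<in> carrier_mat n n" "A * adj_mat A = det A \<cdot>\<^sub>m 1\<^sub>m n"
    using adj_mat[OF A] by auto
  have gv: "gv \<in> carrier_vec n" by (simp add: gv_def)
  have w: "w \<in> carrier_vec n" using adj gv by (simp add: w_def)
  have "A *\<^sub>v w = (1 / det A) \<cdot>\<^sub>v (A *\<^sub>v (adj_mat A *\<^sub>v gv))"
    unfolding w_def by (rule mult_mat_vec[OF A]) (use adj gv in auto)
  also have "A *\<^sub>v (adj_mat A *\<^sub>v gv) = (A * adj_mat A) *\<^sub>v gv"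
    by (rule assoc_mult_mat_vec[symmetric]) (use adj gv A in auto)
  also have "\<dots> = det A \<cdot>\<^sub>v gv"
    unfolding adj using gv by (intro eq_vecI) (auto simp: scalar_prod_def if_distrib[of "(*) _"] if_distrib[of "\<lambda>x. x * _"] cong: if_cong)
  also have "(1 / det A) \<cdot>\<^sub>v (det A \<cdot>\<^sub>v gv) = gv"
    using \<open>det A \<noteq> 0\<close> by (simp add: smult_smult_assoc)
  finally have Aw: "A *\<^sub>v w = gv" .
  have "(\<Sum>z\<in>Y. L y z * w $ h' z) = g y" if "y \<in> Y" for y
  proof -
    obtain i where i: "i < n" "y = h i" using Yh \<open>y \<in> Y\<close> by blast
    then show ?thesis using Av[of i w] w Aw by (simp add: gv_def)
  qed
  then show ?thesis by (intro exI[of _ "\<lambda>z. w $ h' z"]) blast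
qed

text \<open>\<alpha> and \<beta> bound the squared norms of the two factors, so a bound on
  \<open>gamma2\<close> corresponds to a bound by its square on \<alpha> * \<beta>. Keeping the two
  apart lets transposition swap them without rescaling.\<close>

definition inner_factored :: "'a set \<Rightarrow> 'b set \<Rightarrow> ('a \<Rightarrow> 'b \<Rightarrow> real) \<Rightarrow> real \<Rightarrow> real \<Rightarrow> bool" where
  "inner_factored X Y a \<alpha> \<beta> \<longleftrightarrow> (\<exists>k u v.
     (\<forall>x\<in>X. \<forall>y\<in>Y. a x y = (\<Sum>i<k::nat. u x i * v y i)) \<and>
     (\<forall>x\<in>X. (\<Sum>i<k. (u x i)\<^sup>2) \<le> \<alpha>) \<and> (\<forall>y\<in>Y. (\<Sum>i<k. (v y i)\<^sup>2) \<le> \<beta>))"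

lemma inner_factored_mono:
  assumes "inner_factored X Y a \<alpha> \<beta>" "X' \<subseteq> X" "Y' \<subseteq> Y"
  shows "inner_factored X' Y' a \<alpha> \<beta>"
  using assms unfolding inner_factored_def by (elim exE, intro exI) (auto dest: subsetD)

lemma inner_factored_transpose:
  assumes "inner_factored X Y a \<alpha> \<beta>"
  shows "inner_factored Y X (\<lambda>y x. a x y) \<beta> \<alpha>"
  using assms unfolding inner_factored_def by (elim exE, intro exI) (auto simp: mult.commute)

text \<open>When \<open>a\<close> is biregular this is Hoelder's inequality between the Schatten 1-, 2- and 4-norms.
  The weights \<open>1 / e z\<close> replace regularity on the column side.\<close>

lemma codegree_lower_bound:
  fixes a :: "'a \<Rightarrow> 'b \<Rightarrow> real"
  assumes fin: "finite X" "finite Y"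
    and a01: "\<And>x y. x \<in> X \<Longrightarrow> y \<in> Y \<Longrightarrow> a x y \<in> {0, 1}"
    and fact: "inner_factored X Y a \<alpha> \<beta>"
    and \<alpha>: "\<alpha> > 0"
  defines "e \<equiv> \<lambda>y. \<Sum>x\<in>X. a x y" and "cod \<equiv> \<lambda>y z. \<Sum>x\<in>X. a x y * a x z"
  shows "(\<Sum>y\<in>Y. e y)\<^sup>2 \<le> \<alpha> * \<beta> * card X * (\<Sum>z\<in>Y. \<Sum>y\<in>Y. (cod y z)\<^sup>2 / e z)"
proof -
  obtain k :: nat and u v
    where uv: "\<And>x y. x \<in> X \<Longrightarrow> y \<in> Y \<Longrightarrow> a x y = (\<Sum>i<k. u x i * v y i)"
      and u: "\<And>x. x \<in> X \<Longrightarrow> (\<Sum>i<k. (u x i)\<^sup>2) \<le> \<alpha>"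
      and v: "\<And>y. y \<in> Y \<Longrightarrow> (\<Sum>i<k. (v y i)\<^sup>2) \<le> \<beta>"
    using fact unfolding inner_factored_def by blast
  define m where "m = (\<Sum>y\<in>Y. e y)"
  define Q where "Q = (\<Sum>z\<in>Y. \<Sum>y\<in>Y. (cod y z)\<^sup>2 / e z)"
  have a_ge: "0 \<le> a x y" and a_sq: "a x y * a x y = a x y" if "x \<in> X" "y \<in> Y" for x y
    using a01[OF that] by auto
  have e_ge: "0 \<le> e y" if "y \<in> Y" for y using a_ge that by (auto simp: e_def intro: sum_nonneg)
  have e0: "a x y = 0" if "x \<in> X" "y \<in> Y" "e y = 0" for x y
    using that a_ge fin by (auto simp: e_def sum_nonneg_eq_0_iff)
  have cod_diag: "cod y y = e y" if "y \<in> Y" for y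
    unfolding cod_def e_def using a_sq that by (intro sum.cong) auto
  have cod_sym: "cod y z = cod z y" for y z by (simp add: cod_def mult.commute)
  have m_ge: "0 \<le> m" unfolding m_def using e_ge by (rule sum_nonneg)
  show ?thesis
  proof (cases "m = 0")
    case True
    \<comment> \<open>Only the sign of the right-hand side is at stake here; the hypotheses make
      \<beta> nonnegative as soon as \<open>Y\<close> has an element.\<close>
    have "0 \<le> \<alpha> * \<beta> * card X * Q"
    proof (cases "Y = {}")
      case False
      then obtain y where "y \<in> Y" by blast
      have "0 \<le> (\<Sum>i<k. (v y i)\<^sup>2)" by (rule sum_nonneg) simp
      then have "0 \<le> \<beta>" using v[OF \<open>y \<in> Y\<close>] by linarith
      moreover have "0 \<le> Q" unfolding Q_def using e_ge by (intro sum_nonneg) simp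
      ultimately show ?thesis using \<alpha> by simp
    qed (simp add: Q_def)
    then show ?thesis using True by (simp add: m_def Q_def)
  next
    case False
    then have m_pos: "m > 0" using m_ge by simp
    then have "X \<noteq> {}" by (auto simp: m_def e_def)
    then have n_pos: "real (card X) > 0" using fin by (simp add: card_gt_0_iff)
    \<comment> \<open>The diagonal terms \<open>y = z\<close> already contribute \<open>e z\<close>
      each.\<close>
    have "m \<le> Q" unfolding m_def Q_def
    proof (rule sum_mono)
      fix z assume z: "z \<in> Y"
      have "e z = (cod z z)\<^sup>2 / e z" using cod_diag[OF z] by (simp add: power2_eq_square)
      also have "\<dots> \<le> (\<Sum>y\<in>Y. (cod y z)\<^sup>2 / e z)"
        using fin z e_ge by (intro member_le_sum) auto
      finally show "e z \<le> (\<Sum>y\<in>Y. (cod y z)\<^sup>2 / e z)" .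
    qed
    then have Q_pos: "Q > 0" using m_pos by simp
    \<comment> \<open>With this weight \<open>l * Q = m\<close>, so the loss
      \<open>(m + l * Q) / 4\<close> in the lower bound for \<tau> is exactly
      \<open>m / 2\<close>.\<close>
    define l where "l = m / Q"
    have l_pos: "l > 0" using m_pos Q_pos by (simp add: l_def)
    \<comment> \<open>\<open>R\<close> is the Gram operator of \<open>P\<close>: with the inner product on \<open>Y\<close> weighted by \<open>e\<close>, it is the
      adjoint of \<open>P\<close> composed with \<open>P\<close>, hence self-adjoint and positive. The columns of the
      dual witness are \<open>P (\<zeta> z)\<close>, where \<open>\<zeta> z\<close> is the resolvent of \<open>R\<close> applied to the indicator
      of \<open>z\<close>.\<close>
    define P where "P f x = (\<Sum>y\<in>Y. a x y * f y)" for f x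
    define R where "R f y = (\<Sum>x\<in>X. a x y * P f x) / e y" for f y
    \<comment> \<open>If \<open>e y = 0\<close>, column \<open>y\<close> vanishes and the division
      by zero in \<open>R\<close> yields 0, so both sides are 0.\<close>
    have eR: "e y * R f y = (\<Sum>x\<in>X. a x y * P f x)" if "y \<in> Y" for y f
      using e0[OF _ that] by (cases "e y = 0") (auto simp: R_def)
    have adj: "(\<Sum>y\<in>Y. e y * f y * R g y) = (\<Sum>x\<in>X. P f x * P g x)" for f g
    proof -
      have "(\<Sum>y\<in>Y. e y * f y * R g y) = (\<Sum>y\<in>Y. \<Sum>x\<in>X. f y * a x y * P g x)"
      proof (rule sum.cong[OF refl])
        fix y assume y: "y \<in> Y"
        have "e y * f y * R g y = f y * (e y * R g y)" by simp
        also have "\<dots> = (\<Sum>x\<in>X. f y * a x y * P g x)"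
          by (simp only: eR[OF y]) (simp add: sum_distrib_left mult.assoc)
        finally show "e y * f y * R g y = (\<Sum>x\<in>X. f y * a x y * P g x)" .
      qed
      also have "\<dots> = (\<Sum>x\<in>X. P f x * P g x)"
        by (subst sum.swap) (simp add: P_def sum_distrib_right mult.commute)
      finally show ?thesis .
    qed
    have R_alt: "R f y = (\<Sum>z\<in>Y. cod y z / e y * f z)" for f y
    proof -
      have "(\<Sum>x\<in>X. a x y * P f x) = (\<Sum>z\<in>Y. cod y z * f z)"
        unfolding P_def cod_def sum_distrib_left sum_distrib_right
        by (subst sum.swap) (simp add: mult.assoc)
      then show ?thesis by (simp add: R_def sum_divide_distrib)
    qed
    have P_sum: "P (\<lambda>y. \<Sum>i\<in>I. c i * f i y) x = (\<Sum>i\<in>I. c i * P (f i) x)"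
      for I :: "'b set" and c f x
      unfolding P_def sum_distrib_left by (subst sum.swap) (simp add: mult.left_commute)
    have R_sum: "R (\<lambda>y. \<Sum>i\<in>I. c i * f i y) y = (\<Sum>i\<in>I. c i * R (f i) y)"
      for I :: "'b set" and c f y
      unfolding R_alt sum_distrib_left by (subst sum.swap) (simp add: mult.left_commute)
    have solvable: "\<exists>f. \<forall>y\<in>Y. f y + l * R f y = g y" for g
    proof -
      have *: "(\<Sum>z\<in>Y. (of_bool (y = z) + l * cod y z / e y) * f z) = f y + l * R f y"
        if "y \<in> Y" for y f
        using that fin by (simp add: distrib_right sum.distrib R_alt sum_distrib_left) (simp add: mult.assoc)
      \<comment> \<open>Pairing the equation with \<open>e * f\<close> leaves two nonnegative terms
        with sum 0. Since \<open>e\<close> may vanish, the first one does not give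
        \<open>f = 0\<close>. The second gives \<open>P f = 0\<close> on \<open>X\<close>, hence
        \<open>R f = 0\<close>, and the equation itself then gives \<open>f = 0\<close>.\<close>
      have "\<forall>y\<in>Y. f y = 0" if f: "\<forall>y\<in>Y. f y + l * R f y = 0" for f
      proof -
        have "0 = (\<Sum>y\<in>Y. e y * f y * (f y + l * R f y))" using f by simp
        also have "\<dots> = (\<Sum>y\<in>Y. e y * (f y)\<^sup>2) + l * (\<Sum>y\<in>Y. e y * f y * R f y)"
          by (simp add: sum_distrib_left sum.distrib algebra_simps power2_eq_square)
        also have "\<dots> = (\<Sum>y\<in>Y. e y * (f y)\<^sup>2) + l * (\<Sum>x\<in>X. (P f x)\<^sup>2)"
          by (simp add: adj power2_eq_square)
        finally have "l * (\<Sum>x\<in>X. (P f x)\<^sup>2) \<le> 0"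
          using sum_nonneg[of Y "\<lambda>y. e y * (f y)\<^sup>2"] e_ge by auto
        then have "(\<Sum>x\<in>X. (P f x)\<^sup>2) \<le> 0" using l_pos by (simp add: mult_le_0_iff)
        then have "(\<Sum>x\<in>X. (P f x)\<^sup>2) = 0" by (intro antisym sum_nonneg) auto
        then have "P f x = 0" if "x \<in> X" for x
          using that fin by (simp add: sum_nonneg_eq_0_iff)
        then have "R f y = 0" for y by (simp add: R_def)
        then show ?thesis using f by simp
      qed
      then show ?thesis
        using square_linear_system_solvable[OF fin(2), of "\<lambda>y z. of_bool (y = z) + l * cod y z / e y" g]
        by (simp add: *)
    qed
    have "\<forall>z. \<exists>f. \<forall>y\<in>Y. f y + l * R f y = of_bool (y = z)"
      by (intro allI solvable)
    then obtain \<zeta> where \<zeta>: "\<And>z y. y \<in> Y \<Longrightarrow> \<zeta> z y + l * R (\<zeta> z) y = of_bool (y = z)"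
      by metis
    have pick_sum: "(\<Sum>y\<in>Y. e y * of_bool (y = z) * h y) = e z * h z" if "z \<in> Y" for z h
    proof -
      have "(\<Sum>y\<in>Y. e y * of_bool (y = z) * h y) = (\<Sum>y\<in>Y. if y = z then e y * h y else 0)"
        by (intro sum.cong) auto
      then show ?thesis using that fin by simp
    qed
    \<comment> \<open>\<tau> is the pairing of \<open>a\<close> with the dual witness. It is bounded
      below by \<open>m / 2\<close> through the resolvent equation and above through the
      factorization of \<open>a\<close>.\<close>
    define \<tau> where "\<tau> = (\<Sum>z\<in>Y. \<Sum>x\<in>X. a x z * P (\<zeta> z) x)"
    \<comment> \<open>This comes from pairing the resolvent equation for \<open>\<zeta> z\<close>
      with \<open>e * R (\<zeta> z)\<close>.\<close>
    have tau1: "(\<Sum>x\<in>X. (P (\<zeta> z) x)\<^sup>2) + l * (\<Sum>y\<in>Y. e y * (R (\<zeta> z) y)\<^sup>2)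
        = (\<Sum>x\<in>X. a x z * P (\<zeta> z) x)" if z: "z \<in> Y" for z
    proof -
      have "(\<Sum>x\<in>X. a x z * P (\<zeta> z) x) = e z * R (\<zeta> z) z" using z by (simp add: eR)
      also have "\<dots> = (\<Sum>y\<in>Y. e y * (\<zeta> z y + l * R (\<zeta> z) y) * R (\<zeta> z) y)"
        using z by (simp add: \<zeta> pick_sum)
      also have "\<dots> = (\<Sum>y\<in>Y. e y * \<zeta> z y * R (\<zeta> z) y) + l * (\<Sum>y\<in>Y. e y * (R (\<zeta> z) y)\<^sup>2)"
        by (simp add: sum_distrib_left sum.distrib algebra_simps power2_eq_square)
      finally show ?thesis by (simp add: adj power2_eq_square)
    qed
    have P1: "P (\<lambda>y. of_bool (y = z)) x = a x z" if "z \<in> Y" for z x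
      using that fin by (simp add: P_def)
    have R1: "R (\<lambda>y. of_bool (y = z)) y = cod y z / e y" if "z \<in> Y" for z y
      using that fin by (simp add: R_alt flip: sum_divide_distrib)
    \<comment> \<open>\<open>e z\<close> is the value at \<open>z\<close> of \<open>e * c\<close>,
      where \<open>c\<close> is \<open>R\<close> applied to the indicator of \<open>z\<close>.
      Expanding the indicator by the resolvent equation gives two products, and \<open>amgm\<close>
      splits them with weight 1 on the squares that make up the left-hand side of
      \<open>tau1\<close>.\<close>
    have ez: "e z \<le> (\<Sum>x\<in>X. a x z * P (\<zeta> z) x) + (e z + l * (\<Sum>y\<in>Y. (cod y z)\<^sup>2 / e y)) / 4"
      if z: "z \<in> Y" for z
    proof -
      define c where "c y = cod y z / e y" for y
      have amgm: "p * q \<le> p\<^sup>2 + q\<^sup>2 / 4" for p q :: real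
        using zero_le_power2[of "p - q / 2"] by (simp add: power2_eq_square algebra_simps)
      have "e z = (\<Sum>x\<in>X. a x z * a x z)"
        unfolding e_def using z by (intro sum.cong) (simp_all add: a_sq)
      also have "\<dots> = e z * c z" unfolding c_def using e0[OF _ z] by (cases "e z = 0") (auto simp: cod_def)
      also have "\<dots> = (\<Sum>y\<in>Y. e y * (\<zeta> z y + l * R (\<zeta> z) y) * c y)"
        using z by (simp add: \<zeta> pick_sum)
      also have "\<dots> = (\<Sum>y\<in>Y. e y * \<zeta> z y * c y) + l * (\<Sum>y\<in>Y. e y * (R (\<zeta> z) y * c y))"
        by (simp add: sum_distrib_left sum.distrib algebra_simps)
      also have "(\<Sum>y\<in>Y. e y * \<zeta> z y * c y) = (\<Sum>x\<in>X. P (\<zeta> z) x * a x z)"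
        using adj[of "\<zeta> z" "\<lambda>y. of_bool (y = z)"] by (simp only: P1[OF z] R1[OF z] c_def)
      also have "\<dots> \<le> (\<Sum>x\<in>X. (P (\<zeta> z) x)\<^sup>2 + (a x z)\<^sup>2 / 4)"
        by (intro sum_mono amgm)
      also have "\<dots> = (\<Sum>x\<in>X. (P (\<zeta> z) x)\<^sup>2) + e z / 4"
        using z by (simp add: sum.distrib e_def power2_eq_square a_sq flip: sum_divide_distrib)
      also have "(\<Sum>y\<in>Y. e y * (R (\<zeta> z) y * c y)) \<le> (\<Sum>y\<in>Y. e y * ((R (\<zeta> z) y)\<^sup>2 + (c y)\<^sup>2 / 4))"
        by (intro sum_mono mult_left_mono amgm e_ge)
      also have "\<dots> = (\<Sum>y\<in>Y. e y * (R (\<zeta> z) y)\<^sup>2) + (\<Sum>y\<in>Y. (cod y z)\<^sup>2 / e y) / 4"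
        by (simp add: c_def distrib_left sum.distrib sum_divide_distrib)
          (intro sum.cong refl, simp add: power2_eq_square)
      finally show ?thesis using tau1[OF z] l_pos by (simp add: distrib_left add_divide_distrib)
    qed
    have "m \<le> (\<Sum>z\<in>Y. (\<Sum>x\<in>X. a x z * P (\<zeta> z) x) + (e z + l * (\<Sum>y\<in>Y. (cod y z)\<^sup>2 / e y)) / 4)"
      unfolding m_def by (intro sum_mono ez)
    also have "\<dots> = \<tau> + (m + l * (\<Sum>z\<in>Y. \<Sum>y\<in>Y. (cod y z)\<^sup>2 / e y)) / 4"
      by (simp only: \<tau>_def m_def sum.distrib flip: sum_distrib_left sum_divide_distrib)
    also have "(\<Sum>z\<in>Y. \<Sum>y\<in>Y. (cod y z)\<^sup>2 / e y) = Q"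
      unfolding Q_def by (subst sum.swap) (simp add: cod_sym)
    also have "l * Q = m" using Q_pos by (simp add: l_def)
    finally have tau_lower: "m / 2 \<le> \<tau>" by simp
    \<comment> \<open>For the \<open>e\<close>-weighted inner product on \<open>Y\<close>, this says
      that \<open>P\<close> composed with the resolvent has norm at most
      \<open>1 / (2 * sqrt l)\<close>. It rests on the pointwise inequality
      \<open>4 * p * q \<le> (p + q)^2\<close>.\<close>
    have P_bound: "(\<Sum>x\<in>X. (P f x)\<^sup>2) \<le> (\<Sum>y\<in>Y. e y * (f y + l * R f y)\<^sup>2) / (4 * l)" for f
    proof -
      have "4 * l * (\<Sum>x\<in>X. (P f x)\<^sup>2) = (\<Sum>y\<in>Y. e y * (4 * l * (f y * R f y)))"
        using adj[of f f] by (simp add: power2_eq_square sum_distrib_left flip: adj) (simp add: algebra_simps)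
      also have "\<dots> \<le> (\<Sum>y\<in>Y. e y * (f y + l * R f y)\<^sup>2)"
      proof (intro sum_mono mult_left_mono e_ge)
        fix y show "4 * l * (f y * R f y) \<le> (f y + l * R f y)\<^sup>2"
          using zero_le_power2[of "f y - l * R f y"] by (simp add: power2_eq_square algebra_simps)
      qed
      finally show ?thesis using l_pos by (simp add: field_simps)
    qed
    \<comment> \<open>\<open>\<theta> i\<close> is the resolvent applied to the \<open>i\<close>-th
      coordinate of the vectors \<open>v\<close>.\<close>
    define \<theta> where "\<theta> i y = (\<Sum>z\<in>Y. v z i * \<zeta> z y)" for i y
    have theta: "\<theta> i y + l * R (\<theta> i) y = v y i" if y: "y \<in> Y" for i y
    proof -
      have "\<theta> i y + l * R (\<theta> i) y = (\<Sum>z\<in>Y. v z i * (\<zeta> z y + l * R (\<zeta> z) y))"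
        unfolding \<theta>_def R_sum by (simp add: sum.distrib sum_distrib_left algebra_simps)
      then show ?thesis using y fin by (simp add: \<zeta>)
    qed
    \<comment> \<open>With this weight in the inequality between arithmetic and geometric means, the
      terms with \<open>u\<close> sum to at most \<open>m / 2\<close>.\<close>
    define \<eta> where "\<eta> = m / (2 * card X * \<alpha>)"
    have eta_pos: "\<eta> > 0" unfolding \<eta>_def using m_pos n_pos \<alpha> by simp
    have "\<tau> = (\<Sum>z\<in>Y. \<Sum>x\<in>X. \<Sum>i<k. u x i * (v z i * P (\<zeta> z) x))"
      unfolding \<tau>_def by (intro sum.cong refl) (simp add: uv sum_distrib_right mult.assoc)
    also have "\<dots> = (\<Sum>x\<in>X. \<Sum>i<k. \<Sum>z\<in>Y. u x i * (v z i * P (\<zeta> z) x))"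
      by (subst sum.swap, intro sum.cong refl, rule sum.swap)
    also have "\<dots> = (\<Sum>x\<in>X. \<Sum>i<k. u x i * P (\<theta> i) x)"
      unfolding \<theta>_def P_sum by (simp add: sum_distrib_left)
    also have "\<dots> \<le> (\<Sum>x\<in>X. \<Sum>i<k. (\<eta> * (u x i)\<^sup>2 + (P (\<theta> i) x)\<^sup>2 / \<eta>) / 2)"
    proof (intro sum_mono)
      fix x i
      have "0 \<le> (\<eta> * u x i - P (\<theta> i) x)\<^sup>2 / (2 * \<eta>)" using eta_pos by simp
      also have "\<dots> = (\<eta> * (u x i)\<^sup>2 + (P (\<theta> i) x)\<^sup>2 / \<eta>) / 2 - u x i * P (\<theta> i) x"
        using eta_pos by (simp add: field_simps power2_eq_square)
      finally show "u x i * P (\<theta> i) x \<le> (\<eta> * (u x i)\<^sup>2 + (P (\<theta> i) x)\<^sup>2 / \<eta>) / 2" by simp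
    qed
    also have "\<dots> = (\<eta> * (\<Sum>x\<in>X. \<Sum>i<k. (u x i)\<^sup>2) + (\<Sum>x\<in>X. \<Sum>i<k. (P (\<theta> i) x)\<^sup>2) / \<eta>) / 2"
      by (simp only: sum.distrib flip: sum_distrib_left sum_divide_distrib)
    also have "(\<Sum>x\<in>X. \<Sum>i<k. (P (\<theta> i) x)\<^sup>2) = (\<Sum>i<k. \<Sum>x\<in>X. (P (\<theta> i) x)\<^sup>2)"
      by (rule sum.swap)
    finally have tau_upper: "2 * \<tau> \<le> \<eta> * (\<Sum>x\<in>X. \<Sum>i<k. (u x i)\<^sup>2) + (\<Sum>i<k. \<Sum>x\<in>X. (P (\<theta> i) x)\<^sup>2) / \<eta>"
      by simp
    have "(\<Sum>x\<in>X. \<Sum>i<k. (u x i)\<^sup>2) \<le> (\<Sum>x\<in>X. \<alpha>)" by (intro sum_mono u)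
    then have "\<eta> * (\<Sum>x\<in>X. \<Sum>i<k. (u x i)\<^sup>2) \<le> \<eta> * (card X * \<alpha>)" using eta_pos by simp
    also have "\<dots> = m / 2" using n_pos \<alpha> by (simp add: \<eta>_def)
    finally have 1: "\<eta> * (\<Sum>x\<in>X. \<Sum>i<k. (u x i)\<^sup>2) \<le> m / 2" .
    have "(\<Sum>i<k. \<Sum>x\<in>X. (P (\<theta> i) x)\<^sup>2) \<le> (\<Sum>i<k. (\<Sum>y\<in>Y. e y * (\<theta> i y + l * R (\<theta> i) y)\<^sup>2) / (4 * l))"
      by (intro sum_mono P_bound)
    also have "\<dots> = (\<Sum>i<k. \<Sum>y\<in>Y. e y * (v y i)\<^sup>2) / (4 * l)"
      by (simp add: theta flip: sum_divide_distrib)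
    also have "(\<Sum>i<k. \<Sum>y\<in>Y. e y * (v y i)\<^sup>2) = (\<Sum>y\<in>Y. e y * (\<Sum>i<k. (v y i)\<^sup>2))"
      by (subst sum.swap) (simp add: sum_distrib_left)
    also have "\<dots> / (4 * l) \<le> (\<Sum>y\<in>Y. e y * \<beta>) / (4 * l)"
      using l_pos by (intro divide_right_mono sum_mono mult_left_mono v e_ge) auto
    also have "\<dots> = Q * \<beta> / 4"
      using m_pos Q_pos by (simp add: l_def m_def flip: sum_distrib_right)
    finally have "(\<Sum>i<k. \<Sum>x\<in>X. (P (\<theta> i) x)\<^sup>2) / \<eta> \<le> Q * \<beta> / 4 / \<eta>"
      using eta_pos by (intro divide_right_mono) auto
    also have "\<dots> = \<alpha> * \<beta> * card X * Q / (2 * m)"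
      using m_pos n_pos \<alpha> by (simp add: \<eta>_def field_simps)
    finally have "m \<le> m / 2 + \<alpha> * \<beta> * card X * Q / (2 * m)" using tau_lower tau_upper 1 by linarith
    then have "m / 2 * (2 * m) \<le> \<alpha> * \<beta> * card X * Q" using m_pos by (simp add: field_simps)
    then show ?thesis by (simp add: m_def Q_def power2_eq_square)
  qed
qed

section \<open>Low degrees in factored matrices\<close>

text \<open>Without a \<open>t\<close>-by-\<open>t\<close> all-ones submatrix, the neighbours of a
  column \<open>z\<close> and the neighbours of a row \<open>x\<close> adjacent to it span a sparse
  submatrix once both sets have size at least \<open>N\<close>. This makes the codegrees too small
  for \<open>codegree_lower_bound\<close>.\<close>

lemma almost_regular_contains_all_ones:
  fixes g :: real and t :: nat
  assumes g: "g > 0" and t: "t > 0"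
  obtains r :: real where
    "\<And>(X :: 'a set) (Y :: 'b set) a \<alpha> \<beta> \<rho>. finite X \<Longrightarrow> finite Y \<Longrightarrow> X \<noteq> {} \<Longrightarrow> card Y \<le> card X \<Longrightarrow>
       (\<And>x y. x \<in> X \<Longrightarrow> y \<in> Y \<Longrightarrow> a x y \<in> {0, 1 :: real}) \<Longrightarrow>
       inner_factored X Y a \<alpha> \<beta> \<Longrightarrow> \<alpha> > 0 \<Longrightarrow> \<alpha> * \<beta> \<le> g \<Longrightarrow> r \<le> \<rho> \<Longrightarrow>
       (\<And>x. x \<in> X \<Longrightarrow> \<rho> \<le> (\<Sum>y\<in>Y. a x y)) \<Longrightarrow> (\<Sum>x\<in>X. \<Sum>y\<in>Y. a x y) \<le> 2 * \<rho> * card X \<Longrightarrow>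
       has_all_ones t X Y a"
proof -
  \<comment> \<open>Columns of degree below \<open>\<epsilon> * \<rho>\<close> contribute at most \<open>8 * \<epsilon> * m\<^sup>2\<close> to the upper bound on
    \<open>m\<^sup>2 / g\<close>, the remaining ones at most \<open>4 * \<delta> * m\<^sup>2\<close>, and \<open>g * (8 * \<epsilon> + 4 * \<delta>) = 1 / 2 < 1\<close>.\<close>
  define \<delta> where "\<delta> = 1 / (16 * g)"
  define \<epsilon> where "\<epsilon> = 1 / (32 * g)"
  have \<delta>: "\<delta> > 0" and \<epsilon>: "\<epsilon> > 0" using g by (auto simp: \<delta>_def \<epsilon>_def)
  obtain N where N: "\<And>(P :: 'a set) (Q :: 'b set) a. finite P \<Longrightarrow> finite Q \<Longrightarrow> N \<le> card P \<Longrightarrow> N \<le> card Q \<Longrightarrow>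
       (\<And>x y. x \<in> P \<Longrightarrow> y \<in> Q \<Longrightarrow> a x y \<in> {0, 1 :: real}) \<Longrightarrow>
       \<delta> * card P * card Q < (\<Sum>x\<in>P. \<Sum>y\<in>Q. a x y) \<Longrightarrow>
       has_all_ones t P Q a"
    using dense_contains_all_ones[OF \<delta> t] by metis
  \<comment> \<open>The first two bounds give \<open>N \<le> \<rho>\<close> and
    \<open>N \<le> \<epsilon> * \<rho>\<close>, which make the neighbourhoods of rows and of heavy
    columns large enough for \<open>N\<close>.\<close>
  define r where "r = max (max N (N / \<epsilon>)) 1"
  show ?thesis
  proof (rule that[of r], rule ccontr)
    fix X :: "'a set" and Y :: "'b set" and a \<alpha> \<beta> \<rho>
    assume fin: "finite X" "finite Y" and X: "X \<noteq> {}" and YX: "card Y \<le> card X"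
      and a01: "\<And>x y. x \<in> X \<Longrightarrow> y \<in> Y \<Longrightarrow> a x y \<in> {0, 1 :: real}"
      and fact: "inner_factored X Y a \<alpha> \<beta>"
      and \<alpha>: "\<alpha> > 0" and \<alpha>\<beta>: "\<alpha> * \<beta> \<le> g" and r: "r \<le> \<rho>"
      and deg: "\<And>x. x \<in> X \<Longrightarrow> \<rho> \<le> (\<Sum>y\<in>Y. a x y)"
      and total: "(\<Sum>x\<in>X. \<Sum>y\<in>Y. a x y) \<le> 2 * \<rho> * card X"
      and no: "\<not> has_all_ones t X Y a"
    have \<rho>: "\<rho> \<ge> N" "\<rho> \<ge> N / \<epsilon>" "\<rho> \<ge> 1" using r by (auto simp: r_def)
    then have \<epsilon>\<rho>: "\<epsilon> * \<rho> \<ge> N" using \<epsilon> by (simp add: field_simps)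
    define D where "D x = (\<Sum>y\<in>Y. a x y)" for x
    \<comment> \<open>By Markov's inequality at least half of the rows survive, since the average
      degree is at most \<open>2 * \<rho>\<close>.\<close>
    define X' where "X' = {x \<in> X. D x \<le> 4 * \<rho>}"
    have X': "X' \<subseteq> X" "finite X'" using fin by (auto simp: X'_def)
    have a_ge: "0 \<le> a x y" if "x \<in> X" "y \<in> Y" for x y using a01[OF that] by auto
    have a_ge': "0 \<le> a x y" and a_le': "a x y \<le> 1"
      if "x \<in> X'" "y \<in> Y" for x y using a01[OF subsetD[OF X'(1) that(1)] that(2)] by auto
    have "(card X - card X') * (4 * \<rho>) = (\<Sum>x\<in>X - X'. 4 * \<rho>)"
      using X' by (simp add: card_Diff_subset)
    also have "\<dots> \<le> (\<Sum>x\<in>X - X'. D x)" by (intro sum_mono) (auto simp: X'_def)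
    also have "\<dots> \<le> (\<Sum>x\<in>X. D x)"
      using fin a_ge by (intro sum_mono2) (auto simp: D_def intro!: sum_nonneg)
    also have "\<dots> \<le> 2 * \<rho> * card X" using total by (simp add: D_def)
    finally have "real (card X - card X') * 2 * (2 * \<rho>) \<le> card X * (2 * \<rho>)" by (simp add: algebra_simps)
    then have "real (card X - card X') * 2 \<le> card X" using \<rho>(3) by (simp del: of_nat_diff)
    moreover have "card X' \<le> card X" using X' fin by (simp add: card_mono)
    ultimately have half: "card X \<le> 2 * card X'" by linarith
    moreover have "card X > 0" using X fin by (simp add: card_gt_0_iff)
    ultimately have n_pos: "real (card X') > 0" by simp
    have Y_le: "real (card Y) \<le> 2 * card X'" using half YX by simp
    define e where "e y = (\<Sum>x\<in>X'. a x y)" for y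
    define cod where "cod y z = (\<Sum>x\<in>X'. a x y * a x z)" for y z
    define m where "m = (\<Sum>y\<in>Y. e y)"
    have e_ge: "0 \<le> e y" if "y \<in> Y" for y
      unfolding e_def using a_ge' that by (intro sum_nonneg) auto
    have "m = (\<Sum>x\<in>X'. D x)" unfolding m_def e_def D_def by (rule sum.swap)
    moreover have "(\<Sum>x\<in>X'. D x) \<ge> (\<Sum>x\<in>X'. \<rho>)"
      using deg X' by (intro sum_mono) (auto simp: D_def)
    ultimately have m_ge: "\<rho> * card X' \<le> m" by (simp add: mult.commute)
    moreover have "0 < \<rho> * card X'" using \<rho>(3) n_pos by (intro mult_pos_pos) auto
    ultimately have m_pos: "m > 0" by linarith
    \<comment> \<open>A light column has few neighbours, all of degree at most
      \<open>4 * \<rho>\<close>, so the trivial bound \<open>cod y z \<le> e z\<close> suffices. For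
      a heavy column the absence of a \<open>t\<close>-by-\<open>t\<close> all-ones submatrix is
      used.\<close>
    have q: "(\<Sum>y\<in>Y. (cod y z)\<^sup>2 / e z) \<le> 4 * \<epsilon> * \<rho>\<^sup>2 + 4 * \<delta> * \<rho> * e z" if z: "z \<in> Y" for z
    proof (cases "e z < \<epsilon> * \<rho>")
      case True
      have "(\<Sum>y\<in>Y. (cod y z)\<^sup>2 / e z) \<le> (\<Sum>y\<in>Y. cod y z)"
      proof (rule sum_mono)
        fix y assume y: "y \<in> Y"
        have "cod y z \<le> e z" unfolding cod_def e_def
          using a_ge' a_le' y z by (intro sum_mono mult_left_le_one_le) auto
        moreover have "0 \<le> cod y z" unfolding cod_def using a_ge' y z by (intro sum_nonneg) auto
        ultimately show "(cod y z)\<^sup>2 / e z \<le> cod y z"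
          by (cases "e z = 0") (auto simp: power2_eq_square divide_le_eq mult_left_mono)
      qed
      also have "\<dots> = (\<Sum>x\<in>X'. a x z * D x)"
        unfolding cod_def D_def by (subst sum.swap) (simp add: sum_distrib_left mult.commute)
      also have "\<dots> \<le> (\<Sum>x\<in>X'. a x z * (4 * \<rho>))"
        using a_ge' z by (intro sum_mono mult_left_mono) (auto simp: X'_def)
      also have "\<dots> = e z * (4 * \<rho>)" by (simp add: e_def sum_distrib_right)
      also have "\<dots> \<le> \<epsilon> * \<rho> * (4 * \<rho>)" using True \<rho> by (intro mult_right_mono) auto
      also have "\<dots> \<le> 4 * \<epsilon> * \<rho>\<^sup>2 + 4 * \<delta> * \<rho> * e z"
        using \<delta> \<rho> e_ge[OF z] by (simp add: power2_eq_square)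
      finally show ?thesis .
    next
      case False
      define P where "P = {x \<in> X'. a x z = 1}"
      have P: "finite P" "P \<subseteq> X" "P \<subseteq> X'" using X' by (auto simp: P_def)
      have sum_P: "(\<Sum>x\<in>X'. a x z * f x) = (\<Sum>x\<in>P. f x)" for f :: "_ \<Rightarrow> real"
        unfolding P_def using X' a01 z by (intro sum.mono_neutral_cong_right) auto
      have eP: "e z = card P" using sum_P[of "\<lambda>_. 1"] by (simp add: e_def)
      have NP: "N \<le> card P" using False \<epsilon>\<rho> eP by linarith
      \<comment> \<open>The left-hand side counts the ones between \<open>P\<close>, the neighbours
        of \<open>z\<close>, and the neighbours of \<open>x\<close>.\<close>
      have row: "(\<Sum>y\<in>Y. a x y * cod y z) \<le> \<delta> * card P * (4 * \<rho>)" if x: "x \<in> P" for x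
      proof -
        define W where "W = {y \<in> Y. a x y = 1}"
        have W: "finite W" "W \<subseteq> Y" using fin by (auto simp: W_def)
        have sum_W: "(\<Sum>y\<in>Y. a x y * f y) = (\<Sum>y\<in>W. f y)" for f :: "_ \<Rightarrow> real"
          unfolding W_def using fin a01 x P by (intro sum.mono_neutral_cong_right) auto
        have DW: "D x = card W" using sum_W[of "\<lambda>_. 1"] by (simp add: D_def)
        have NW: "N \<le> card W" using deg[of x] x P \<rho> DW by (auto simp: D_def)
        have a01_PW: "a x y \<in> {0, 1}" if "x \<in> P" "y \<in> W" for x y
          using a01 P W that by blast
        have "(\<Sum>y\<in>Y. a x y * cod y z) = (\<Sum>y\<in>W. \<Sum>x'\<in>P. a x' y)"
          by (subst sum_W) (simp add: cod_def mult.commute[of "a _ _" "a _ z"] sum_P)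
        also have "\<dots> = (\<Sum>x'\<in>P. \<Sum>y\<in>W. a x' y)" by (rule sum.swap)
        also have "\<dots> \<le> \<delta> * card P * card W"
        proof (rule ccontr)
          assume "\<not> ?thesis"
          then have "has_all_ones t P W a"
            using P W a01_PW by (intro N NP NW) auto
          then show False using no P(2) W(2) has_all_ones_mono by blast
        qed
        also have "\<dots> \<le> \<delta> * card P * (4 * \<rho>)"
          using \<delta> x P DW by (intro mult_left_mono) (auto simp: X'_def)
        finally show ?thesis .
      qed
      \<comment> \<open>Expanding one factor of the square turns the sum into a sum, over the
        neighbours of \<open>z\<close>, of the counts bounded in \<open>row\<close>.\<close>
      have "(\<Sum>y\<in>Y. (cod y z)\<^sup>2) = (\<Sum>y\<in>Y. \<Sum>x\<in>X'. a x z * (a x y * cod y z))"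
        by (simp add: cod_def power2_eq_square sum_distrib_right mult.assoc mult.left_commute)
      also have "\<dots> = (\<Sum>x\<in>X'. a x z * (\<Sum>y\<in>Y. a x y * cod y z))"
        by (subst sum.swap) (simp add: sum_distrib_left)
      also have "\<dots> = (\<Sum>x\<in>P. \<Sum>y\<in>Y. a x y * cod y z)" by (rule sum_P)
      also have "\<dots> \<le> (\<Sum>x\<in>P. \<delta> * card P * (4 * \<rho>))" by (intro sum_mono row)
      also have "\<dots> = (4 * \<delta> * \<rho> * e z) * e z" by (simp add: eP)
      finally have "(\<Sum>y\<in>Y. (cod y z)\<^sup>2) / e z \<le> 4 * \<delta> * \<rho> * e z"
        using e_ge[OF z] \<delta> \<rho> by (cases "e z = 0") (auto simp: divide_le_eq)
      moreover have "0 \<le> 4 * \<epsilon> * \<rho>\<^sup>2" using \<epsilon> by simp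
      ultimately show ?thesis by (simp add: sum_divide_distrib)
    qed
    have "m\<^sup>2 \<le> \<alpha> * \<beta> * card X' * (\<Sum>z\<in>Y. \<Sum>y\<in>Y. (cod y z)\<^sup>2 / e z)"
      unfolding m_def e_def cod_def
      by (rule codegree_lower_bound[OF X'(2) fin(2) a01[OF subsetD[OF X'(1)]]
            inner_factored_mono[OF fact X'(1) subset_refl] \<alpha>])
    also have "\<dots> \<le> g * card X' * (\<Sum>z\<in>Y. \<Sum>y\<in>Y. (cod y z)\<^sup>2 / e z)"
      using \<alpha>\<beta> e_ge by (intro mult_right_mono sum_nonneg) auto
    also have "\<dots> \<le> g * card X' * (\<Sum>z\<in>Y. 4 * \<epsilon> * \<rho>\<^sup>2 + 4 * \<delta> * \<rho> * e z)"
      using g by (intro mult_left_mono sum_mono q) auto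
    also have "(\<Sum>z\<in>Y. 4 * \<epsilon> * \<rho>\<^sup>2 + 4 * \<delta> * \<rho> * e z) = card Y * (4 * \<epsilon> * \<rho>\<^sup>2) + 4 * \<delta> * \<rho> * m"
      by (simp add: sum.distrib m_def sum_distrib_left)
    also have "g * card X' * (card Y * (4 * \<epsilon> * \<rho>\<^sup>2) + 4 * \<delta> * \<rho> * m)
        \<le> g * card X' * (2 * card X' * (4 * \<epsilon> * \<rho>\<^sup>2) + 4 * \<delta> * \<rho> * m)"
      using g \<epsilon> Y_le by (intro mult_left_mono add_right_mono mult_right_mono) auto
    also have "\<dots> = ((\<rho> * card X') * (\<rho> * card X') + (\<rho> * card X') * m) / 4"
      using g by (simp add: \<epsilon>_def \<delta>_def field_simps power2_eq_square)
    also have "\<dots> \<le> (m * m + m * m) / 4"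
      using m_ge \<rho> n_pos m_pos by (intro divide_right_mono add_mono mult_mono) auto
    finally have "m\<^sup>2 \<le> 0" by (simp add: power2_eq_square)
    then show False using m_pos by simp
  qed
qed

lemma low_degree_vertex:
  fixes g :: real and t :: nat
  assumes g: "g > 0" and t: "t > 0"
  obtains d :: nat where
    "\<And>(X :: 'a set) (Y :: 'b set) a \<alpha> \<beta>. finite X \<Longrightarrow> finite Y \<Longrightarrow> X \<noteq> {} \<or> Y \<noteq> {} \<Longrightarrow>
       (\<And>x y. x \<in> X \<Longrightarrow> y \<in> Y \<Longrightarrow> a x y \<in> {0, 1 :: real}) \<Longrightarrow>
       inner_factored X Y a \<alpha> \<beta> \<Longrightarrow> \<alpha> > 0 \<Longrightarrow> \<beta> > 0 \<Longrightarrow> \<alpha> * \<beta> \<le> g \<Longrightarrow>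
       \<not> has_all_ones t X Y a \<Longrightarrow>
       (\<exists>x\<in>X. (\<Sum>y\<in>Y. a x y) \<le> real d) \<or> (\<exists>y\<in>Y. (\<Sum>x\<in>X. a x y) \<le> real d)"
proof -
  obtain r1 where r1: "\<And>(X :: 'a set) (Y :: 'b set) a \<alpha> \<beta> \<rho>. finite X \<Longrightarrow> finite Y \<Longrightarrow> X \<noteq> {} \<Longrightarrow>
       card Y \<le> card X \<Longrightarrow>
       (\<And>x y. x \<in> X \<Longrightarrow> y \<in> Y \<Longrightarrow> a x y \<in> {0, 1 :: real}) \<Longrightarrow>
       inner_factored X Y a \<alpha> \<beta> \<Longrightarrow> \<alpha> > 0 \<Longrightarrow> \<alpha> * \<beta> \<le> g \<Longrightarrow> r1 \<le> \<rho> \<Longrightarrow>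
       (\<And>x. x \<in> X \<Longrightarrow> \<rho> \<le> (\<Sum>y\<in>Y. a x y)) \<Longrightarrow> (\<Sum>x\<in>X. \<Sum>y\<in>Y. a x y) \<le> 2 * \<rho> * card X \<Longrightarrow>
       has_all_ones t X Y a"
    by (rule almost_regular_contains_all_ones[OF g t]) blast
  \<comment> \<open>Transposition swaps the types of the row and column indices, so the transposed
    case takes its own instance with its own constant.\<close>
  obtain r2 where r2: "\<And>(X :: 'b set) (Y :: 'a set) a \<alpha> \<beta> \<rho>. finite X \<Longrightarrow> finite Y \<Longrightarrow> X \<noteq> {} \<Longrightarrow>
       card Y \<le> card X \<Longrightarrow>
       (\<And>x y. x \<in> X \<Longrightarrow> y \<in> Y \<Longrightarrow> a x y \<in> {0, 1 :: real}) \<Longrightarrow>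
       inner_factored X Y a \<alpha> \<beta> \<Longrightarrow> \<alpha> > 0 \<Longrightarrow> \<alpha> * \<beta> \<le> g \<Longrightarrow> r2 \<le> \<rho> \<Longrightarrow>
       (\<And>x. x \<in> X \<Longrightarrow> \<rho> \<le> (\<Sum>y\<in>Y. a x y)) \<Longrightarrow> (\<Sum>x\<in>X. \<Sum>y\<in>Y. a x y) \<le> 2 * \<rho> * card X \<Longrightarrow>
       has_all_ones t X Y a"
    by (rule almost_regular_contains_all_ones[OF g t]) blast
  \<comment> \<open>If all degrees exceed \<open>d\<close>, then twice the number of ones is at
    least \<open>d * (card X + card Y)\<close>, so \<rho> is at least \<open>d / 2\<close>, which
    has to reach both thresholds.\<close>
  define d where "d = nat \<lceil>2 * max r1 r2\<rceil>"
  have d: "r1 \<le> d / 2" "r2 \<le> d / 2" unfolding d_def by linarith+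
  show ?thesis
  proof (rule that[of d], rule ccontr)
    fix X :: "'a set" and Y :: "'b set" and a \<alpha> \<beta>
    assume fin: "finite X" "finite Y" and XY: "X \<noteq> {} \<or> Y \<noteq> {}"
      and a01: "\<And>x y. x \<in> X \<Longrightarrow> y \<in> Y \<Longrightarrow> a x y \<in> {0, 1 :: real}"
      and fact: "inner_factored X Y a \<alpha> \<beta>"
      and \<alpha>: "\<alpha> > 0" and \<beta>: "\<beta> > 0" and \<alpha>\<beta>: "\<alpha> * \<beta> \<le> g"
      and no: "\<not> has_all_ones t X Y a"
      and high: "\<not> ((\<exists>x\<in>X. (\<Sum>y\<in>Y. a x y) \<le> real d) \<or> (\<exists>y\<in>Y. (\<Sum>x\<in>X. a x y) \<le> real d))"
    \<comment> \<open>In the submatrix that attains \<open>\<rho>\<close> all degrees are at least \<open>\<rho>\<close>, and the average degree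
      on the larger side is at most \<open>2 * \<rho>\<close>.\<close>
    define E where "E S T = (\<Sum>x\<in>S. \<Sum>y\<in>T. a x y)" for S T
    have E_swap: "E S T = (\<Sum>y\<in>T. \<Sum>x\<in>S. a x y)" for S T unfolding E_def by (rule sum.swap)
    define w where "w S T = real (card S) + real (card T)" for S :: "'a set" and T :: "'b set"
    \<comment> \<open>Without the empty pair all the weights \<open>w\<close> are positive.\<close>
    define F where "F = Pow X \<times> Pow Y - {({}, {})}"
    define \<rho> where "\<rho> = Max ((\<lambda>(S, T). E S T / w S T) ` F)"
    have F: "finite F" "(X, Y) \<in> F" using fin XY by (auto simp: F_def)
    then have "\<rho> \<in> (\<lambda>(S, T). E S T / w S T) ` F" unfolding \<rho>_def by (intro Max_in) auto
    then obtain X1 Y1 where F1: "(X1, Y1) \<in> F" and \<rho>1: "\<rho> = E X1 Y1 / w X1 Y1" by auto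
    have sub: "X1 \<subseteq> X" "Y1 \<subseteq> Y" and fin1: "finite X1" "finite Y1"
      using F1 fin by (auto simp: F_def intro: finite_subset)
    have w_pos: "w S T > 0" if "(S, T) \<in> F" for S T
    proof -
      have "finite S" "finite T" "S \<noteq> {} \<or> T \<noteq> {}"
        using that fin by (auto simp: F_def intro: finite_subset)
      then have "card S > 0 \<or> card T > 0" by (auto simp: card_gt_0_iff)
      then show ?thesis by (auto simp: w_def)
    qed
    have max: "E S T \<le> \<rho> * w S T" if "S \<subseteq> X" "T \<subseteq> Y" for S T
    proof (cases "(S, T) \<in> F")
      case True
      then have "E S T / w S T \<le> \<rho>" unfolding \<rho>_def using F by (intro Max_ge) auto
      then show ?thesis using w_pos[OF True] by (simp add: divide_le_eq)
    next
      case False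
      then show ?thesis using that by (auto simp: F_def E_def w_def)
    qed
    have E1: "E X1 Y1 = \<rho> * w X1 Y1" using w_pos[OF F1] \<rho>1 by simp
    have "(\<Sum>x\<in>X. real d) \<le> E X Y" unfolding E_def using high by (intro sum_mono) force
    moreover have "(\<Sum>y\<in>Y. real d) \<le> E X Y" unfolding E_swap using high by (intro sum_mono) force
    ultimately have "real d * w X Y \<le> 2 * E X Y" by (simp add: w_def algebra_simps)
    also have "\<dots> \<le> 2 * (\<rho> * w X Y)" using max[of X Y] by simp
    finally have "real d * w X Y \<le> (2 * \<rho>) * w X Y" by simp
    then have \<rho>: "d / 2 \<le> \<rho>" using w_pos[OF F(2)] by (simp add: mult_le_cancel_right)
    then have \<rho>0: "0 \<le> \<rho>" by (meson divide_nonneg_nonneg of_nat_0_le_iff order_trans zero_le_numeral)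
    \<comment> \<open>Deleting row \<open>x\<close> lowers \<open>w\<close> by 1 and cannot raise
      the ratio above its maximum \<rho>, so the row holds at least \<rho> ones.\<close>
    have row: "\<rho> \<le> (\<Sum>y\<in>Y1. a x y)" if x: "x \<in> X1" for x
    proof -
      have "E X1 Y1 = (\<Sum>y\<in>Y1. a x y) + E (X1 - {x}) Y1"
        unfolding E_def using fin1 x by (simp add: sum.remove)
      moreover have "E (X1 - {x}) Y1 \<le> \<rho> * w (X1 - {x}) Y1" using sub by (intro max) auto
      moreover have "w (X1 - {x}) Y1 = w X1 Y1 - 1"
        using fin1 x card_Suc_Diff1[of X1 x] by (simp add: w_def)
      ultimately show ?thesis using E1 by (simp add: algebra_simps)
    qed
    have col: "\<rho> \<le> (\<Sum>x\<in>X1. a x y)" if y: "y \<in> Y1" for y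
    proof -
      have "E X1 Y1 = (\<Sum>x\<in>X1. a x y) + E X1 (Y1 - {y})"
        unfolding E_swap using fin1 y by (simp add: sum.remove)
      moreover have "E X1 (Y1 - {y}) \<le> \<rho> * w X1 (Y1 - {y})" using sub by (intro max) auto
      moreover have "w X1 (Y1 - {y}) = w X1 Y1 - 1"
        using fin1 y card_Suc_Diff1[of Y1 y] by (simp add: w_def)
      ultimately show ?thesis using E1 by (simp add: algebra_simps)
    qed
    have a01': "a x y \<in> {0, 1}" if "x \<in> X1" "y \<in> Y1" for x y using a01 sub that by blast
    have fact1: "inner_factored X1 Y1 a \<alpha> \<beta>" using inner_factored_mono[OF fact sub] .
    have ne: "X1 \<noteq> {} \<or> Y1 \<noteq> {}" using F1 by (auto simp: F_def)
    show False
    proof (cases "card Y1 \<le> card X1")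
      case True
      have "X1 \<noteq> {}" using True ne fin1 by auto
      moreover have "E X1 Y1 \<le> 2 * \<rho> * card X1"
        unfolding E1 w_def using True mult_left_mono[OF _ \<rho>0, of "real (card Y1)" "real (card X1)"]
        by (simp add: algebra_simps)
      ultimately have "has_all_ones t X1 Y1 a"
        using fin1 True a01' fact1 \<alpha> \<alpha>\<beta> \<rho> d row
        by (intro r1[of X1 Y1 a \<alpha> \<beta> \<rho>]) (auto simp: E_def)
      then show False using no sub has_all_ones_mono by blast
    next
      case False
      then have le: "card X1 \<le> card Y1" by simp
      have "Y1 \<noteq> {}" using False by auto
      moreover have "E X1 Y1 \<le> 2 * \<rho> * card Y1"
        unfolding E1 w_def using le mult_left_mono[OF _ \<rho>0, of "real (card X1)" "real (card Y1)"]
        by (simp add: algebra_simps)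
      ultimately have "has_all_ones t Y1 X1 (\<lambda>y x. a x y)"
        using fin1 le a01' inner_factored_transpose[OF fact1] \<beta> \<alpha>\<beta> \<rho> d col
        by (intro r2[of Y1 X1 "\<lambda>y x. a x y" \<beta> \<alpha> \<rho>]) (auto simp: E_swap mult.commute)
      then show False using no sub has_all_ones_mono has_all_ones_transpose by blast
    qed
  qed
qed

section \<open>Submatrices, degeneracy and factorization norm\<close>

text \<open>\<open>pick I\<close> enumerates \<open>I\<close> in increasing order, so the elements
  below \<open>n\<close> come first. This translates positions in a submatrix into indices of the
  matrix, also for infinite \<open>I\<close>.\<close>

lemma bij_betw_pick:
  "bij_betw (pick I) {..<card {i. i < n \<and> i \<in> I}} {i. i < n \<and> i \<in> I}"
proof -
  let ?S = "{i. i < n \<and> i \<in> I}"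
  have into: "pick I ` {..<card ?S} \<subseteq> ?S"
  proof
    fix r assume "r \<in> pick I ` {..<card ?S}"
    then obtain i where i: "i < card ?S" "r = pick I i" by blast
    have "card ?S \<le> card I" if "finite I" using that by (intro card_mono) auto
    then have "pick I i \<in> I" using i by (intro pick_in_set) force
    then show "r \<in> ?S" using i pick_le by blast
  qed
  have "?S \<subseteq> pick I ` {..<card ?S}"
  proof
    fix i assume i: "i \<in> ?S"
    have "card {a \<in> I. a < i} < card ?S"
      using i by (intro psubset_card_mono) auto
    moreover have "pick I (card {a \<in> I. a < i}) = i" using i by (simp add: pick_card_in_set)
    ultimately show "i \<in> pick I ` {..<card ?S}" by (intro image_eqI[of _ _ "card {a \<in> I. a < i}"]) simp_all
  qed
  with into have img: "pick I ` {..<card ?S} = ?S" by blast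
  then have "inj_on (pick I) {..<card ?S}" by (intro eq_card_imp_inj_on) auto
  then show ?thesis using img by (simp add: bij_betw_def)
qed

lemma bij_betw_card_Collect:
  assumes "bij_betw h {..<n} Y"
  shows "card {j. j < n \<and> P (h j)} = card {y \<in> Y. P y}"
proof -
  have "{y \<in> Y. P y} = h ` {j. j < n \<and> P (h j)}"
    using bij_betw_imp_surj_on[OF assms] by blast
  moreover have "inj_on h {j. j < n \<and> P (h j)}"
    using bij_betw_imp_inj_on[OF assms] by (rule inj_on_subset) blast
  ultimately show ?thesis by (simp add: card_image)
qed

lemma has_all_ones_imp_contains_all_ones:
  assumes "has_all_ones t {..<dim_row M} {..<dim_col M} (\<lambda>i j. M $$ (i, j))"
  shows "contains_all_ones M t"
proof -
  obtain I J where IJ: "I \<subseteq> {..<dim_row M}" "J \<subseteq> {..<dim_col M}" "card I = t" "card J = t"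
    "\<forall>x\<in>I. \<forall>y\<in>J. M $$ (x, y) = 1"
    using assms unfolding has_all_ones_def by (elim exE conjE)
  have eq: "{i. i < dim_row M \<and> i \<in> I} = I" "{j. j < dim_col M \<and> j \<in> J} = J" using IJ(1,2) by auto
  have "pick I i \<in> I" if "i < t" for i
    using bij_betw_pick[of I "dim_row M"] that unfolding eq IJ by (auto simp: bij_betw_def)
  moreover have "pick J j \<in> J" if "j < t" for j
    using bij_betw_pick[of J "dim_col M"] that unfolding eq IJ by (auto simp: bij_betw_def)
  ultimately have "submatrix M I J = mat t t (\<lambda>_. 1)"
    using IJ(5) by (intro eq_matI) (auto simp: submatrix_def eq IJ(3,4))
  then show ?thesis unfolding contains_all_ones_def by blast
qed

text \<open>The right-hand side avoids renumbering by representing a submatrix through its row and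
  column indices in \<open>M\<close>. The sets \<open>I\<close> and \<open>J\<close> may exceed the
  range of indices; \<open>R I\<close> and \<open>C J\<close> are what remains of them.\<close>

lemma degenerate_within_iff:
  "degenerate_within M d \<longleftrightarrow>
     (\<forall>X Y. X \<subseteq> {..<dim_row M} \<longrightarrow> Y \<subseteq> {..<dim_col M} \<longrightarrow> X \<noteq> {} \<or> Y \<noteq> {} \<longrightarrow>
        (\<exists>x\<in>X. card {y \<in> Y. M $$ (x, y) = 1} \<le> d) \<or> (\<exists>y\<in>Y. card {x \<in> X. M $$ (x, y) = 1} \<le> d))"
    (is "_ \<longleftrightarrow> (\<forall>X Y. ?P X Y)")
proof -
  define R where "R I = {i. i < dim_row M \<and> i \<in> I}" for I
  define C where "C J = {j. j < dim_col M \<and> j \<in> J}" for J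
  have sub: "(let S = submatrix M I J in dim_row S > 0 \<or> dim_col S > 0 \<longrightarrow>
     (\<exists>i<dim_row S. card {j. j < dim_col S \<and> S $$ (i, j) = 1} \<le> d) \<or>
     (\<exists>j<dim_col S. card {i. i < dim_row S \<and> S $$ (i, j) = 1} \<le> d)) \<longleftrightarrow> ?P (R I) (C J)" for I J
  proof -
    define S where "S = submatrix M I J"
    have dim: "dim_row S = card (R I)" "dim_col S = card (C J)"
      by (simp_all add: S_def dim_submatrix R_def C_def)
    have fin: "finite (R I)" "finite (C J)" by (simp_all add: R_def C_def)
    have bR: "bij_betw (pick I) {..<card (R I)} (R I)" and bC: "bij_betw (pick J) {..<card (C J)} (C J)"
      unfolding R_def C_def by (rule bij_betw_pick)+
    have S: "S $$ (i, j) = M $$ (pick I i, pick J j)" if "i < card (R I)" "j < card (C J)" for i j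
      using that by (simp add: S_def submatrix_index R_def C_def)
    have row: "card {j. j < dim_col S \<and> S $$ (i, j) = 1} = card {y \<in> C J. M $$ (pick I i, y) = 1}"
      if "i < card (R I)" for i
      unfolding bij_betw_card_Collect[OF bC, symmetric] dim
      by (intro arg_cong[of _ _ card] Collect_cong) (use S[OF that] in auto)
    have col: "card {i. i < dim_row S \<and> S $$ (i, j) = 1} = card {x \<in> R I. M $$ (x, pick J j) = 1}"
      if "j < card (C J)" for j
      unfolding bij_betw_card_Collect[OF bR, symmetric] dim
      by (intro arg_cong[of _ _ card] Collect_cong) (use S[OF _ that] in auto)
    have "(\<exists>i<card (R I). card {y \<in> C J. M $$ (pick I i, y) = 1} \<le> d)
        \<longleftrightarrow> (\<exists>x\<in>R I. card {y \<in> C J. M $$ (x, y) = 1} \<le> d)"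
      by (subst bij_betw_imp_surj_on[OF bR, symmetric]) auto
    moreover have "(\<exists>j<card (C J). card {x \<in> R I. M $$ (x, pick J j) = 1} \<le> d)
        \<longleftrightarrow> (\<exists>y\<in>C J. card {x \<in> R I. M $$ (x, y) = 1} \<le> d)"
      by (subst bij_betw_imp_surj_on[OF bC, symmetric]) auto
    moreover have "(\<exists>i<dim_row S. card {j. j < dim_col S \<and> S $$ (i, j) = 1} \<le> d)
        \<longleftrightarrow> (\<exists>i<card (R I). card {y \<in> C J. M $$ (pick I i, y) = 1} \<le> d)"
      using row dim by auto
    moreover have "(\<exists>j<dim_col S. card {i. i < dim_row S \<and> S $$ (i, j) = 1} \<le> d)
        \<longleftrightarrow> (\<exists>j<card (C J). card {x \<in> R I. M $$ (x, pick J j) = 1} \<le> d)"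
      using col dim by auto
    moreover have "R I \<subseteq> {..<dim_row M}" "C J \<subseteq> {..<dim_col M}" by (auto simp: R_def C_def)
    moreover have "dim_row S > 0 \<longleftrightarrow> R I \<noteq> {}" "dim_col S > 0 \<longleftrightarrow> C J \<noteq> {}"
      using fin by (simp_all add: dim card_gt_0_iff)
    ultimately show ?thesis unfolding Let_def S_def[symmetric] by simp
  qed
  \<comment> \<open>\<open>R\<close> and \<open>C\<close> fix every set of valid indices, so all
    pairs of such sets arise.\<close>
  have P: "?P X Y" if all: "\<forall>I J. ?P (R I) (C J)" for X Y
  proof (cases "X \<subseteq> {..<dim_row M} \<and> Y \<subseteq> {..<dim_col M}")
    case True
    have "R X = X" "C Y = Y" using True by (auto simp: R_def C_def)
    show ?thesis using spec[OF spec[OF all], of X Y] unfolding \<open>R X = X\<close> \<open>C Y = Y\<close> .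
  next
    case False
    then show ?thesis by (intro impI) (elim notE, rule conjI)
  qed
  show ?thesis unfolding degenerate_within_def sub
  proof
    assume "\<forall>I J. ?P (R I) (C J)"
    then show "\<forall>X Y. ?P X Y" using P by (intro allI)
  next
    assume all: "\<forall>X Y. ?P X Y"
    show "\<forall>I J. ?P (R I) (C J)" by (intro allI) (rule spec[OF spec[OF all]])
  qed
qed

lemma degenerate_within_mono:
  assumes "degenerate_within M d" "d \<le> d'"
  shows "degenerate_within M d'"
  unfolding degenerate_within_iff
proof (intro allI impI)
  fix X Y assume XY: "X \<subseteq> {..<dim_row M}" "Y \<subseteq> {..<dim_col M}" "X \<noteq> {} \<or> Y \<noteq> {}"
  show "(\<exists>x\<in>X. card {y \<in> Y. M $$ (x, y) = 1} \<le> d') \<or> (\<exists>y\<in>Y. card {x \<in> X. M $$ (x, y) = 1} \<le> d')"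
    using assms(1)[unfolded degenerate_within_iff, rule_format, OF XY]
  proof (elim disjE bexE)
    fix x assume "x \<in> X" "card {y \<in> Y. M $$ (x, y) = 1} \<le> d"
    then show ?thesis using assms(2) by (intro disjI1 bexI[of _ x]) linarith
  next
    fix y assume "y \<in> Y" "card {x \<in> X. M $$ (x, y) = 1} \<le> d"
    then show ?thesis using assms(2) by (intro disjI2 bexI[of _ y]) linarith
  qed
qed

lemma degeneracy_le_iff: "degeneracy M \<le> d \<longleftrightarrow> degenerate_within M d"
  using degenerate_within_mono[OF degenerate_within_degeneracy] Least_le[of "degenerate_within M" d]
  unfolding degeneracy_def by blast

section \<open>Row and column norms and the factorization norm\<close>

lemma vec_l2_norm_power2: "(vec_l2_norm v)\<^sup>2 = (\<Sum>i<dim_vec v. (v $ i)\<^sup>2)"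
proof -
  have "0 \<le> v \<bullet> v" unfolding scalar_prod_def by (intro sum_nonneg) simp
  then show ?thesis
    by (simp add: vec_l2_norm_def) (simp add: scalar_prod_def power2_eq_square atLeast0LessThan)
qed

lemma row_norm_ge:
  assumes "i < dim_row U"
  shows "(\<Sum>j<dim_col U. (U $$ (i, j))\<^sup>2) \<le> (row_norm U)\<^sup>2"
proof -
  have "row U i \<in> set (rows U)" using assms by (auto simp: rows_def)
  then have "vec_l2_norm (row U i) \<le> row_norm U" unfolding row_norm_def by (intro Max_ge) auto
  moreover have "0 \<le> vec_l2_norm (row U i)"
    by (auto simp: vec_l2_norm_def scalar_prod_def intro: sum_nonneg)
  ultimately have "(vec_l2_norm (row U i))\<^sup>2 \<le> (row_norm U)\<^sup>2" by (rule power_mono)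
  then show ?thesis using assms by (simp add: vec_l2_norm_power2)
qed

lemma row_norm_nonneg: "0 \<le> row_norm U"
  unfolding row_norm_def by (intro Max_ge) auto

lemma col_norm_eq_row_norm_transpose: "col_norm V = row_norm V\<^sup>T"
  by (simp add: col_norm_def row_norm_def)

lemma row_norm_le:
  assumes "0 \<le> c" "\<And>i. i < dim_row U \<Longrightarrow> (\<Sum>j<dim_col U. (U $$ (i, j))\<^sup>2) \<le> c\<^sup>2"
  shows "row_norm U \<le> c"
  unfolding row_norm_def
proof (intro Max.boundedI)
  fix r assume "r \<in> insert 0 (vec_l2_norm ` set (rows U))"
  then consider "r = 0" | i where "i < dim_row U" "r = vec_l2_norm (row U i)"
    by (auto simp: rows_def)
  then show "r \<le> c"
  proof cases
    case 2
    then have "r\<^sup>2 \<le> c\<^sup>2" using assms(2)[of i] by (simp add: vec_l2_norm_power2)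
    then show ?thesis using assms(1) by (rule power2_le_imp_le)
  qed (use assms in simp)
qed auto

text \<open>The strict bound yields a factorization below \<open>c\<close> without knowing that the
  infimum is attained. The norms of its factors may be 0, so both are raised by a small \<eta> to
  make \<alpha> and \<beta> positive.\<close>

lemma inner_factored_if_gamma2_less:
  assumes "gamma2 M < c"
  obtains \<alpha> \<beta> where "\<alpha> > 0" "\<beta> > 0" "\<alpha> * \<beta> \<le> c\<^sup>2"
    "inner_factored {..<dim_row M} {..<dim_col M} (\<lambda>i j. M $$ (i, j)) \<alpha> \<beta>"
proof -
  let ?F = "{row_norm U * col_norm V | U V k.
     U \<in> carrier_mat (dim_row M) k \<and> V \<in> carrier_mat k (dim_col M) \<and> U * V = M}"
  \<comment> \<open>The factorization through the identity shows that the infimum is over a nonempty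
    set.\<close>
  have "M \<in> carrier_mat (dim_row M) (dim_col M)" by simp
  then have "row_norm M * col_norm (1\<^sub>m (dim_col M)) \<in> ?F"
    using one_carrier_mat right_mult_one_mat by blast
  then have "\<exists>r\<in>?F. r < c" using assms unfolding gamma2_def by (intro cInf_lessD) blast+
  then obtain U V k where U: "U \<in> carrier_mat (dim_row M) k" and V: "V \<in> carrier_mat k (dim_col M)"
    and UV: "U * V = M" and less: "row_norm U * col_norm V < c" by blast
  define p where "p = row_norm U"
  define q where "q = col_norm V"
  have pq: "0 \<le> p" "0 \<le> q" "p * q < c"
    using less by (auto simp: p_def q_def row_norm_nonneg col_norm_eq_row_norm_transpose)
  \<comment> \<open>Since \<eta> \<le> 1, raising both norms increases their product by at most
    \<open>\<eta> * (p + q + 1)\<close>, which is at most the gap \<open>c - p * q\<close>.\<close>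
  define \<eta> where "\<eta> = min 1 ((c - p * q) / (p + q + 1))"
  have \<eta>: "0 < \<eta>" "\<eta> \<le> 1" "\<eta> \<le> (c - p * q) / (p + q + 1)"
    using pq by (auto simp: \<eta>_def)
  have "(p + \<eta>) * (q + \<eta>) = p * q + \<eta> * (p + q + \<eta>)" by (simp add: algebra_simps)
  also have "\<dots> \<le> p * q + \<eta> * (p + q + 1)" using \<eta> by simp
  finally have "(p + \<eta>) * (q + \<eta>) \<le> c" using \<eta>(3) pq by (simp add: pos_le_divide_eq)
  then have le: "((p + \<eta>) * (q + \<eta>))\<^sup>2 \<le> c\<^sup>2" using pq \<eta> by (intro power_mono) auto
  have "p\<^sup>2 \<le> (p + \<eta>)\<^sup>2" "q\<^sup>2 \<le> (q + \<eta>)\<^sup>2" using pq \<eta> by (auto intro!: power_mono)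
  moreover have "\<forall>x\<in>{..<dim_row M}. (\<Sum>i<k. (U $$ (x, i))\<^sup>2) \<le> p\<^sup>2"
    using row_norm_ge[of _ U] U by (auto simp: p_def)
  moreover have "\<forall>y\<in>{..<dim_col M}. (\<Sum>i<k. (V $$ (i, y))\<^sup>2) \<le> q\<^sup>2"
    using row_norm_ge[of _ "V\<^sup>T"] V by (auto simp: q_def col_norm_eq_row_norm_transpose)
  moreover have "\<forall>x\<in>{..<dim_row M}. \<forall>y\<in>{..<dim_col M}.
      M $$ (x, y) = (\<Sum>i<k. U $$ (x, i) * V $$ (i, y))"
  proof (intro ballI)
    fix x y assume "x \<in> {..<dim_row M}" "y \<in> {..<dim_col M}"
    then have "(U * V) $$ (x, y) = (\<Sum>i<k. U $$ (x, i) * V $$ (i, y))"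
      using U V by (simp add: scalar_prod_def atLeast0LessThan)
    then show "M $$ (x, y) = (\<Sum>i<k. U $$ (x, i) * V $$ (i, y))" unfolding UV .
  qed
  ultimately have "inner_factored {..<dim_row M} {..<dim_col M} (\<lambda>i j. M $$ (i, j)) ((p + \<eta>)\<^sup>2) ((q + \<eta>)\<^sup>2)"
    unfolding inner_factored_def
    by (intro exI[of _ k] exI[of _ "\<lambda>x i. U $$ (x, i)"] exI[of _ "\<lambda>y i. V $$ (i, y)"])
      (meson order_trans)
  then show ?thesis
    using pq \<eta> le by (intro that[of "(p + \<eta>)\<^sup>2" "(q + \<eta>)\<^sup>2"]) (auto simp: power_mult_distrib)
qed

lemma gamma2_le:
  assumes "inner_factored {..<dim_row M} {..<dim_col M} (\<lambda>i j. M $$ (i, j)) c c" "0 \<le> c"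
  shows "gamma2 M \<le> c"
proof -
  obtain k u v where uv: "\<forall>x\<in>{..<dim_row M}. \<forall>y\<in>{..<dim_col M}. M $$ (x, y) = (\<Sum>i<k::nat. u x i * v y i)"
    "\<forall>x\<in>{..<dim_row M}. (\<Sum>i<k. (u x i)\<^sup>2) \<le> c" "\<forall>y\<in>{..<dim_col M}. (\<Sum>i<k. (v y i)\<^sup>2) \<le> c"
    using assms(1) unfolding inner_factored_def by blast
  define U where "U = mat (dim_row M) k (\<lambda>(x, i). u x i)"
  define V where "V = mat k (dim_col M) (\<lambda>(i, y). v y i)"
  have UV: "U \<in> carrier_mat (dim_row M) k" "V \<in> carrier_mat k (dim_col M)"
    by (simp_all add: U_def V_def)
  have "U * V = M"
    using uv(1) by (intro eq_matI) (auto simp: U_def V_def scalar_prod_def atLeast0LessThan)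
  then have "row_norm U * col_norm V \<in> {row_norm U * col_norm V | U V k.
     U \<in> carrier_mat (dim_row M) k \<and> V \<in> carrier_mat k (dim_col M) \<and> U * V = M}"
    using UV by blast
  moreover have "0 \<le> row_norm U * col_norm V" for U V
    by (simp add: row_norm_nonneg col_norm_eq_row_norm_transpose)
  ultimately have "gamma2 M \<le> row_norm U * col_norm V"
    unfolding gamma2_def by (intro cInf_lower bdd_belowI[of _ 0]) (assumption, blast)
  also have "\<dots> \<le> sqrt c * sqrt c"
    unfolding col_norm_eq_row_norm_transpose
    using assms(2) uv(2,3)
    by (intro mult_mono row_norm_le row_norm_nonneg) (auto simp: U_def V_def)
  also have "\<dots> = c" using assms(2) by simp
  finally show ?thesis .
qed

section \<open>Sums of thin blocky matrices\<close>

text \<open>A colour class below \<open>d\<close> is a union of disjoint stars centred at columns,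
  and one from \<open>d\<close> on is a union of disjoint stars centred at rows. Both shapes are
  thin blocky.\<close>

definition star_colouring :: "nat \<Rightarrow> 'a set \<Rightarrow> 'b set \<Rightarrow> ('a \<Rightarrow> 'b \<Rightarrow> bool) \<Rightarrow> ('a \<Rightarrow> 'b \<Rightarrow> nat) \<Rightarrow> bool" where
  "star_colouring d X Y A f \<longleftrightarrow>
     (\<forall>x\<in>X. \<forall>y\<in>Y. A x y \<longrightarrow> f x y < 2 * d) \<and>
     (\<forall>x\<in>X. \<forall>y\<in>Y. \<forall>y'\<in>Y. A x y \<longrightarrow> A x y' \<longrightarrow> f x y = f x y' \<longrightarrow> f x y < d \<longrightarrow> y = y') \<and>
     (\<forall>y\<in>Y. \<forall>x\<in>X. \<forall>x'\<in>X. A x y \<longrightarrow> A x' y \<longrightarrow> f x y = f x' y \<longrightarrow> d \<le> f x y \<longrightarrow> x = x')"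

text \<open>A row or column with at most \<open>d\<close> ones is removed, the rest is coloured by
  induction, and the removed ones get distinct colours. A removed row uses colours below
  \<open>d\<close>, which constrain only entries of the same row, so nothing conflicts with the
  other rows; columns are symmetric.\<close>

lemma ex_star_colouring:
  assumes "finite X" "finite Y"
    and "\<And>S T. S \<subseteq> X \<Longrightarrow> T \<subseteq> Y \<Longrightarrow> S \<noteq> {} \<or> T \<noteq> {} \<Longrightarrow>
      (\<exists>x\<in>S. card {y \<in> T. A x y} \<le> d) \<or> (\<exists>y\<in>T. card {x \<in> S. A x y} \<le> d)"
  shows "\<exists>f. star_colouring d X Y A f"
  using assms
proof (induction "card X + card Y" arbitrary: X Y rule: less_induct)
  case less
  note fin = less.prems(1,2)
  show ?case
  proof (cases "X = {} \<and> Y = {}")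
    case False
    then consider (row) x where "x \<in> X" "card {y \<in> Y. A x y} \<le> d"
      | (col) y where "y \<in> Y" "card {x \<in> X. A x y} \<le> d"
      using less.prems(3)[of X Y] by blast
    then show ?thesis
    proof cases
      case row
      have "card (X - {x}) < card X" using fin(1) row(1) by (rule card_Diff1_less)
      then have lt: "card (X - {x}) + card Y < card X + card Y" by linarith
      have sub: "(\<exists>x\<in>S. card {y \<in> T. A x y} \<le> d) \<or> (\<exists>y\<in>T. card {x \<in> S. A x y} \<le> d)"
        if "S \<subseteq> X - {x}" "T \<subseteq> Y" "S \<noteq> {} \<or> T \<noteq> {}" for S T
        using less.prems(3)[of S T] that by blast
      obtain f where F: "star_colouring d (X - {x}) Y A f"
        using less.hyps[OF lt finite_Diff[OF fin(1)] fin(2) sub] by blast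
      note f = F[unfolded star_colouring_def, THEN conjunct1, rule_format]
        F[unfolded star_colouring_def, THEN conjunct2, THEN conjunct1, rule_format]
        F[unfolded star_colouring_def, THEN conjunct2, THEN conjunct2, rule_format]
      have "finite {y \<in> Y. A x y}" using fin by simp
      then obtain h where h: "inj_on h {y \<in> Y. A x y}" "h ` {y \<in> Y. A x y} \<subseteq> {..<d}"
        using inj_on_iff_card_le[of "{y \<in> Y. A x y}" "{..<d}"] row by auto
      have hd: "h y < d" if "y \<in> Y" "A x y" for y using h(2) that by blast
      have hi: "y = y'" if "y \<in> Y" "y' \<in> Y" "A x y" "A x y'" "h y = h y'" for y y'
        using inj_onD[OF h(1) that(5)] that by blast
      define g where "g = f(x := h)"
      have gx: "g x = h" and gn: "x' \<noteq> x \<Longrightarrow> g x' = f x'" for x' by (auto simp: g_def)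
      have "star_colouring d X Y A g"
        unfolding star_colouring_def
      proof (intro conjI ballI impI)
        fix x' y assume *: "x' \<in> X" "y \<in> Y" "A x' y"
        show "g x' y < 2 * d" using * hd[of y] f(1)[of x' y] by (cases "x' = x") (auto simp: gx gn)
      next
        fix x' y y' assume *: "x' \<in> X" "y \<in> Y" "y' \<in> Y" "A x' y" "A x' y'" "g x' y = g x' y'" "g x' y < d"
        show "y = y'" using * hi[of y y'] f(2)[of x' y y'] by (cases "x' = x") (auto simp: gx gn)
      next
        fix y x' x'' assume *: "y \<in> Y" "x' \<in> X" "x'' \<in> X" "A x' y" "A x'' y" "g x' y = g x'' y" "d \<le> g x' y"
        have "x' \<noteq> x" using * hd[of y] by (auto simp: gx)
        moreover have "x'' \<noteq> x" using * hd[of y] by (auto simp: gx)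
        ultimately show "x' = x''" using * f(3)[of y x' x''] by (simp add: gn)
      qed
      then show ?thesis by blast
    next
      case col
      have "card (Y - {y}) < card Y" using fin(2) col(1) by (rule card_Diff1_less)
      then have lt: "card X + card (Y - {y}) < card X + card Y" by linarith
      have sub: "(\<exists>x\<in>S. card {y \<in> T. A x y} \<le> d) \<or> (\<exists>y\<in>T. card {x \<in> S. A x y} \<le> d)"
        if "S \<subseteq> X" "T \<subseteq> Y - {y}" "S \<noteq> {} \<or> T \<noteq> {}" for S T
        using less.prems(3)[of S T] that by blast
      obtain f where F: "star_colouring d X (Y - {y}) A f"
        using less.hyps[OF lt fin(1) finite_Diff[OF fin(2)] sub] by blast
      note f = F[unfolded star_colouring_def, THEN conjunct1, rule_format]
        F[unfolded star_colouring_def, THEN conjunct2, THEN conjunct1, rule_format]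
        F[unfolded star_colouring_def, THEN conjunct2, THEN conjunct2, rule_format]
      have "finite {x \<in> X. A x y}" using fin by simp
      then obtain h where h: "inj_on h {x \<in> X. A x y}" "h ` {x \<in> X. A x y} \<subseteq> {..<d}"
        using inj_on_iff_card_le[of "{x \<in> X. A x y}" "{..<d}"] col by auto
      have hd: "h x < d" if "x \<in> X" "A x y" for x using h(2) that by blast
      have hi: "x = x'" if "x \<in> X" "x' \<in> X" "A x y" "A x' y" "h x = h x'" for x x'
        using inj_onD[OF h(1) that(5)] that by blast
      \<comment> \<open>The shift by \<open>d\<close> moves the colours of the removed column into
        the range reserved for columns.\<close>
      define g where "g x = (f x)(y := d + h x)" for x
      have gy: "g x y = d + h x" and gn: "y' \<noteq> y \<Longrightarrow> g x y' = f x y'" for x y' by (auto simp: g_def)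
      have "star_colouring d X Y A g"
        unfolding star_colouring_def
      proof (intro conjI ballI impI)
        fix x y' assume *: "x \<in> X" "y' \<in> Y" "A x y'"
        show "g x y' < 2 * d" using * hd[of x] f(1)[of x y'] by (cases "y' = y") (auto simp: gy gn)
      next
        fix x y' y'' assume *: "x \<in> X" "y' \<in> Y" "y'' \<in> Y" "A x y'" "A x y''" "g x y' = g x y''" "g x y' < d"
        have "y' \<noteq> y" using *(7) by (auto simp: gy)
        moreover have "y'' \<noteq> y" using *(6,7) by (auto simp: gy)
        ultimately show "y' = y''" using * f(2)[of x y' y''] by (simp add: gn)
      next
        fix y' x x' assume *: "y' \<in> Y" "x \<in> X" "x' \<in> X" "A x y'" "A x' y'" "g x y' = g x' y'" "d \<le> g x y'"
        show "x = x'" using * hi[of x x'] f(3)[of y' x x'] by (cases "y' = y") (auto simp: gy gn)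
      qed
      then show ?thesis by blast
    qed
  next
    case True
    then have "star_colouring d X Y A f" for f by (simp add: star_colouring_def)
    then show ?thesis by blast
  qed
qed

section \<open>Thin blocky matrices from colour classes\<close>

lemma boolean_mat_iff:
  "boolean_mat M \<longleftrightarrow> (\<forall>x<dim_row M. \<forall>y<dim_col M. M $$ (x, y) \<in> {0, 1})"
proof -
  have "elements_mat M = {M $$ (x, y) | x y. x < dim_row M \<and> y < dim_col M}"
    by (force simp: elements_mat_def)
  then show ?thesis unfolding boolean_mat_def by blast
qed

lemma boolean_mat_index:
  "boolean_mat M \<Longrightarrow> x < dim_row M \<Longrightarrow> y < dim_col M \<Longrightarrow> M $$ (x, y) \<in> {0, 1}"
  by (simp add: boolean_mat_iff)

lemma boolean_mat_transpose: "boolean_mat M \<Longrightarrow> boolean_mat M\<^sup>T"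
  by (simp add: boolean_mat_iff)

lemma blocky_partitionD:
  assumes "blocky_partition M k A B"
  shows "disjoint_family_on A {0..k}" "(\<Union>i\<in>{0..k}. A i) = {0..<dim_row M}"
    "disjoint_family_on B {0..k}" "(\<Union>i\<in>{0..k}. B i) = {0..<dim_col M}"
    "\<And>i. i \<in> {1..k} \<Longrightarrow> A i \<noteq> {} \<and> B i \<noteq> {}"
    "\<And>i r c. i \<in> {1..k} \<Longrightarrow> r \<in> A i \<Longrightarrow> c \<in> B i \<Longrightarrow> M $$ (r, c) = 1"
    "\<And>i j r c. i \<in> {0..k} \<Longrightarrow> j \<in> {0..k} \<Longrightarrow> i \<noteq> j \<or> i = 0 \<and> j = 0 \<Longrightarrow> r \<in> A i \<Longrightarrow> c \<in> B j \<Longrightarrow>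
      M $$ (r, c) = 0"
  using assms unfolding blocky_partition_def by simp_all

lemma blocky_partition_transpose:
  assumes "blocky_partition M k A B"
  shows "blocky_partition M\<^sup>T k B A"
proof -
  note D = blocky_partitionD[OF assms]
  have T: "M\<^sup>T $$ (c, r) = M $$ (r, c)" if "i \<in> {0..k}" "j \<in> {0..k}" "r \<in> A i" "c \<in> B j" for r c i j
  proof -
    have "r \<in> (\<Union>i\<in>{0..k}. A i)" "c \<in> (\<Union>i\<in>{0..k}. B i)" using that by blast+
    then show ?thesis unfolding D(2,4) by simp
  qed
  show ?thesis
    unfolding blocky_partition_def
  proof (intro conjI ballI impI)
    fix i c r assume "i \<in> {1..k}" "c \<in> B i" "r \<in> A i"
    then show "M\<^sup>T $$ (c, r) = 1" using T[of i i r c] D(6)[of i r c] by simp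
  next
    fix i j c r assume *: "i \<in> {0..k}" "j \<in> {0..k}" "i \<noteq> j \<or> i = 0 \<and> j = 0" "c \<in> B i" "r \<in> A j"
    have "M $$ (r, c) = 0" using * by (intro D(7)[of j i]) auto
    then show "M\<^sup>T $$ (c, r) = 0" using T[OF *(2,1,5,4)] by simp
  next
    fix i assume "i \<in> {1..k}"
    then show "A i \<noteq> {}" "B i \<noteq> {}" using D(5)[of i] by auto
  qed (use D(1-4) in \<open>simp_all only: index_transpose_mat\<close>)
qed

lemma thin_blocky_transpose: "thin_blocky M \<Longrightarrow> thin_blocky M\<^sup>T"
proof -
  assume "thin_blocky M"
  then obtain k A B where M: "boolean_mat M" "blocky_partition M k A B"
    "\<forall>i\<in>{1..k}. card (A i) = 1 \<or> card (B i) = 1" unfolding thin_blocky_def by blast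
  then show "thin_blocky M\<^sup>T"
    using boolean_mat_transpose blocky_partition_transpose unfolding thin_blocky_def by blast
qed

text \<open>Each nonzero column is the column side of one block, whose row side consists of the rows
  with their unique one there. Zero rows and zero columns go to index 0, because the parts of
  positive index must be nonempty.\<close>

lemma thin_blocky_if_rows_unique:
  assumes "boolean_mat M"
    and uniq: "\<And>x y y'. x < dim_row M \<Longrightarrow> y < dim_col M \<Longrightarrow> y' < dim_col M \<Longrightarrow>
      M $$ (x, y) = 1 \<Longrightarrow> M $$ (x, y') = 1 \<Longrightarrow> y = y'"
  shows "thin_blocky M"
proof -
  define C where "C = {y. y < dim_col M \<and> (\<exists>x<dim_row M. M $$ (x, y) = 1)}"
  have "finite C" by (simp add: C_def)
  then obtain h where h: "bij_betw h {1..card C} C" using ex_bij_betw_nat_finite_1 by blast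
  define k where "k = card C"
  have hC: "h i \<in> C" if "i \<in> {1..k}" for i using h that by (auto simp: bij_betw_def k_def)
  have Ch: "\<exists>i\<in>{1..k}. y = h i" if "y \<in> C" for y using h that by (auto simp: bij_betw_def k_def)
  have h_inj: "i = j" if "i \<in> {1..k}" "j \<in> {1..k}" "h i = h j" for i j
    using inj_onD[OF bij_betw_imp_inj_on[OF h] that(3)] that(1,2) unfolding k_def by blast
  define A where "A i = (if i = 0 then {x. x < dim_row M \<and> (\<forall>y<dim_col M. M $$ (x, y) = 0)}
    else {x. x < dim_row M \<and> M $$ (x, h i) = 1})" for i
  define B where "B i = (if i = 0 then {..<dim_col M} - C else {h i})" for i
  have h_less: "h i < dim_col M" if "i \<in> {1..k}" for i using hC[OF that] by (simp add: C_def)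
  have bool: "M $$ (x, y) = 0 \<or> M $$ (x, y) = 1" if "x < dim_row M" "y < dim_col M" for x y
    using boolean_mat_index[OF assms(1) that] by simp
  have cases0: "i = 0 \<or> i \<in> {1..k}" if "i \<in> {0..k}" for i using that by auto
  have "blocky_partition M k A B"
    unfolding blocky_partition_def
  proof (intro conjI ballI impI)
    show "disjoint_family_on A {0..k}"
      unfolding disjoint_family_on_def
    proof (intro ballI impI)
      fix i j assume ij: "i \<in> {0..k}" "j \<in> {0..k}" "i \<noteq> j"
      have "x \<notin> A j" if x: "x \<in> A i" for x
      proof
        assume x': "x \<in> A j"
        show False
        proof (cases "i = 0 \<or> j = 0")
          case True
          then show False using ij x x' cases0 h_less by (auto simp: A_def split: if_splits)
        next
          case False
          then have "h i = h j" using ij x x' cases0 h_less by (intro uniq[of x]) (auto simp: A_def)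
          then show False using h_inj ij False cases0 by blast
        qed
      qed
      then show "A i \<inter> A j = {}" by blast
    qed
    show "disjoint_family_on B {0..k}"
      unfolding disjoint_family_on_def
    proof (intro ballI impI)
      fix i j assume ij: "i \<in> {0..k}" "j \<in> {0..k}" "i \<noteq> j"
      show "B i \<inter> B j = {}"
        using ij hC[of i] hC[of j] h_inj[of i j] by (auto simp: B_def)
    qed
    show "(\<Union>i\<in>{0..k}. A i) = {0..<dim_row M}"
    proof (intro equalityI subsetI)
      fix x assume x: "x \<in> {0..<dim_row M}"
      show "x \<in> (\<Union>i\<in>{0..k}. A i)"
      proof (cases "\<forall>y<dim_col M. M $$ (x, y) = 0")
        case True
        then show ?thesis using x by (intro UN_I[of 0]) (auto simp: A_def)
      next
        case False
        then obtain y where y: "y < dim_col M" "M $$ (x, y) = 1" using bool x by auto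
        then have "y \<in> C" using x by (auto simp: C_def)
        then obtain i where "i \<in> {1..k}" "y = h i" using Ch by blast
        then show ?thesis using x y by (intro UN_I[of i]) (auto simp: A_def)
      qed
    qed (auto simp: A_def split: if_splits)
    show "(\<Union>i\<in>{0..k}. B i) = {0..<dim_col M}"
    proof (intro equalityI subsetI)
      fix y assume y: "y \<in> {0..<dim_col M}"
      show "y \<in> (\<Union>i\<in>{0..k}. B i)"
      proof (cases "y \<in> C")
        case True
        then obtain i where "i \<in> {1..k}" "y = h i" using Ch by blast
        then show ?thesis by (intro UN_I[of i]) (auto simp: B_def)
      next
        case False
        then show ?thesis using y by (intro UN_I[of 0]) (auto simp: B_def)
      qed
    qed (use h_less in \<open>auto simp: B_def split: if_splits\<close>)
  next
    fix i assume i: "i \<in> {1..k}"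
    show "A i \<noteq> {}" using hC[OF i] i by (auto simp: A_def C_def)
    show "B i \<noteq> {}" by (cases "i = 0") (use i in \<open>auto simp: B_def\<close>)
  next
    fix i r c assume "i \<in> {1..k}" "r \<in> A i" "c \<in> B i"
    then show "M $$ (r, c) = 1" by (auto simp: A_def B_def)
  next
    fix i j r c assume *: "i \<in> {0..k}" "j \<in> {0..k}" "i \<noteq> j \<or> i = 0 \<and> j = 0" "r \<in> A i" "c \<in> B j"
    have r: "r < dim_row M" using * by (auto simp: A_def split: if_splits)
    have c: "c < dim_col M" using * h_less cases0[of j] by (auto simp: B_def split: if_splits)
    show "M $$ (r, c) = 0"
    proof (cases "i = 0 \<or> j = 0")
      case True
      then show ?thesis
      proof
        assume "i = 0" then show ?thesis using * c by (simp add: A_def)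
      next
        assume "j = 0" then show ?thesis using * bool[OF r c] r by (auto simp: B_def C_def)
      qed
    next
      case False
      then have ij: "i \<in> {1..k}" "j \<in> {1..k}" using * cases0 by blast+
      have "M $$ (r, c) \<noteq> 1"
      proof
        assume "M $$ (r, c) = 1"
        then have "h i = h j" using * False ij h_less r by (intro uniq[of r]) (auto simp: A_def B_def)
        then show False using h_inj ij * False by blast
      qed
      then show ?thesis using bool[OF r c] by simp
    qed
  qed
  moreover have "\<forall>i\<in>{1..k}. card (B i) = 1" by (auto simp: B_def)
  ultimately show ?thesis unfolding thin_blocky_def using assms(1) by blast
qed

lemma thin_blocky_if_cols_unique:
  assumes "boolean_mat M"
    and "\<And>y x x'. y < dim_col M \<Longrightarrow> x < dim_row M \<Longrightarrow> x' < dim_row M \<Longrightarrow>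
      M $$ (x, y) = 1 \<Longrightarrow> M $$ (x', y) = 1 \<Longrightarrow> x = x'"
  shows "thin_blocky M"
proof -
  have "thin_blocky M\<^sup>T"
    using boolean_mat_transpose[OF assms(1)]
    by (rule thin_blocky_if_rows_unique) (use assms(2) in auto)
  then have "thin_blocky (M\<^sup>T)\<^sup>T" by (rule thin_blocky_transpose)
  then show ?thesis by simp
qed

lemma foldr_plus_mat_carrier:
  "(\<And>B. B \<in> set Bs \<Longrightarrow> B \<in> carrier_mat nr nc) \<Longrightarrow> foldr (+) Bs (0\<^sub>m nr nc) \<in> carrier_mat nr nc"
  by (induction Bs) auto

lemma foldr_plus_mat_index:
  fixes Bs :: "real mat list"
  assumes "\<And>B. B \<in> set Bs \<Longrightarrow> B \<in> carrier_mat nr nc" "x < nr" "y < nc"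
  shows "foldr (+) Bs (0\<^sub>m nr nc) $$ (x, y) = (\<Sum>B\<leftarrow>Bs. B $$ (x, y))"
  using assms(1)
proof (induction Bs)
  case (Cons B Bs)
  then have "foldr (+) Bs (0\<^sub>m nr nc) \<in> carrier_mat nr nc" by (intro foldr_plus_mat_carrier) auto
  then show ?case using Cons assms(2,3) by simp
qed (use assms in simp)

text \<open>The summands are the \<open>2 * d\<close> colour classes of a star colouring, and every
  one of \<open>M\<close> lies in exactly one of them.\<close>

lemma thin_blocky_sum_if_degenerate_within:
  assumes M: "boolean_mat M" and d: "degenerate_within M d"
  shows "\<exists>Bs. length Bs \<le> 2 * d \<and>
     (\<forall>B\<in>set Bs. B \<in> carrier_mat (dim_row M) (dim_col M) \<and> thin_blocky B) \<and>
     M = foldr (+) Bs (0\<^sub>m (dim_row M) (dim_col M))"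
proof -
  let ?X = "{..<dim_row M}" and ?Y = "{..<dim_col M}"
  have fin: "finite ?X" "finite ?Y" by simp_all
  obtain f where F: "star_colouring d ?X ?Y (\<lambda>x y. M $$ (x, y) = 1) f"
    using ex_star_colouring[OF fin d[unfolded degenerate_within_iff, rule_format]] by blast
  note f = F[unfolded star_colouring_def, THEN conjunct1]
    F[unfolded star_colouring_def, THEN conjunct2, THEN conjunct1]
    F[unfolded star_colouring_def, THEN conjunct2, THEN conjunct2]
  define P where "P i = mat (dim_row M) (dim_col M) (\<lambda>(x, y). of_bool (M $$ (x, y) = 1 \<and> f x y = i) :: real)" for i
  define Bs where "Bs = map P [0..<2 * d]"
  have carrier: "B \<in> carrier_mat (dim_row M) (dim_col M)" if "B \<in> set Bs" for B
    using that by (auto simp: Bs_def P_def)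
  have sum_carrier: "foldr (+) Bs (0\<^sub>m (dim_row M) (dim_col M)) \<in> carrier_mat (dim_row M) (dim_col M)"
    using carrier by (rule foldr_plus_mat_carrier)
  have "thin_blocky (P i)" for i
  proof -
    have bool: "boolean_mat (P i)" by (simp add: boolean_mat_iff P_def)
    show ?thesis
    proof (cases "i < d")
      case True
      then show ?thesis
        using bool f(2) by (intro thin_blocky_if_rows_unique) (auto simp: P_def)
    next
      case False
      then show ?thesis
        using bool f(3) by (intro thin_blocky_if_cols_unique) (auto simp: P_def)
    qed
  qed
  then have "\<forall>B\<in>set Bs. B \<in> carrier_mat (dim_row M) (dim_col M) \<and> thin_blocky B"
    using carrier by (auto simp: Bs_def)
  moreover have "M = foldr (+) Bs (0\<^sub>m (dim_row M) (dim_col M))"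
  proof (rule eq_matI)
    fix x y assume "x < dim_row (foldr (+) Bs (0\<^sub>m (dim_row M) (dim_col M)))"
      "y < dim_col (foldr (+) Bs (0\<^sub>m (dim_row M) (dim_col M)))"
    then have xy: "x < dim_row M" "y < dim_col M"
      using sum_carrier by auto
    have "foldr (+) Bs (0\<^sub>m (dim_row M) (dim_col M)) $$ (x, y) = (\<Sum>B\<leftarrow>Bs. B $$ (x, y))"
      using carrier xy by (rule foldr_plus_mat_index)
    also have "\<dots> = (\<Sum>i<2 * d. P i $$ (x, y))"
      by (simp add: Bs_def comp_def interv_sum_list_conv_sum_set_nat atLeast0LessThan)
    also have "\<dots> = (\<Sum>i<2 * d. if i = f x y then of_bool (M $$ (x, y) = 1) else 0)"
      using xy by (intro sum.cong) (auto simp: P_def)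
    also have "\<dots> = M $$ (x, y)"
      using f(1) xy boolean_mat_index[OF M xy] by auto
    finally show "M $$ (x, y) = foldr (+) Bs (0\<^sub>m (dim_row M) (dim_col M)) $$ (x, y)" by simp
  qed (use sum_carrier in auto)
  ultimately show ?thesis by (intro exI[of _ Bs]) (simp add: Bs_def)
qed

section \<open>Factorizations of blocky matrices and of their sums\<close>

lemma inner_factored_plus:
  assumes "inner_factored X Y a \<alpha> \<beta>" "inner_factored X Y b \<alpha>' \<beta>'"
  shows "inner_factored X Y (\<lambda>x y. a x y + b x y) (\<alpha> + \<alpha>') (\<beta> + \<beta>')"
proof -
  obtain k u v where 1: "\<forall>x\<in>X. \<forall>y\<in>Y. a x y = (\<Sum>i<k::nat. u x i * v y i)"
    "\<forall>x\<in>X. (\<Sum>i<k. (u x i)\<^sup>2) \<le> \<alpha>" "\<forall>y\<in>Y. (\<Sum>i<k. (v y i)\<^sup>2) \<le> \<beta>"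
    using assms(1) unfolding inner_factored_def by blast
  obtain k' u' v' where 2: "\<forall>x\<in>X. \<forall>y\<in>Y. b x y = (\<Sum>i<k'::nat. u' x i * v' y i)"
    "\<forall>x\<in>X. (\<Sum>i<k'. (u' x i)\<^sup>2) \<le> \<alpha>'" "\<forall>y\<in>Y. (\<Sum>i<k'. (v' y i)\<^sup>2) \<le> \<beta>'"
    using assms(2) unfolding inner_factored_def by blast
  have split: "(\<Sum>i<k + k'. f i) = (\<Sum>i<k. f i) + (\<Sum>i<k'. f (k + i))" for f :: "nat \<Rightarrow> real"
    by (induction k') (simp_all add: add.assoc)
  define U where "U x i = (if i < k then u x i else u' x (i - k))" for x i
  define V where "V y i = (if i < k then v y i else v' y (i - k))" for y i
  show ?thesis
    unfolding inner_factored_def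
    by (intro exI[of _ "k + k'"] exI[of _ U] exI[of _ V] conjI ballI)
      (use 1 2 in \<open>simp_all add: split U_def V_def add_mono\<close>)
qed

lemma inner_factored_zero: "inner_factored X Y (\<lambda>x y. 0) 0 0"
  unfolding inner_factored_def by (intro exI[of _ "0::nat"]) simp

lemma inner_factored_cong:
  assumes "\<And>x y. x \<in> X \<Longrightarrow> y \<in> Y \<Longrightarrow> a x y = b x y"
  shows "inner_factored X Y a \<alpha> \<beta> \<longleftrightarrow> inner_factored X Y b \<alpha> \<beta>"
  using assms unfolding inner_factored_def by simp

text \<open>A row or column is sent to the indicator vector of the block containing it, which is a
  unit vector. Coordinate 0 is suppressed, so rows in \<open>A 0\<close> and columns in
  \<open>B 0\<close> are sent to 0 and their products vanish.\<close>

lemma inner_factored_blocky_partition: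
  assumes "blocky_partition M k A B"
  shows "inner_factored {..<dim_row M} {..<dim_col M} (\<lambda>x y. M $$ (x, y)) 1 1"
proof -
  note D = blocky_partitionD[OF assms]
  have disj: "i = j" if "i \<in> {0..k}" "j \<in> {0..k}" "x \<in> A i" "x \<in> A j" for x i j
    using disjoint_family_onD[OF D(1) that(1,2)] that(3,4) by blast
  have disj': "i = j" if "i \<in> {0..k}" "j \<in> {0..k}" "y \<in> B i" "y \<in> B j" for y i j
    using disjoint_family_onD[OF D(3) that(1,2)] that(3,4) by blast
  have exA: "\<exists>i\<in>{0..k}. x \<in> A i" if "x < dim_row M" for x
    using that equalityD2[OF D(2)] by auto
  have exB: "\<exists>i\<in>{0..k}. y \<in> B i" if "y < dim_col M" for y
    using that equalityD2[OF D(4)] by auto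
  define u where "u x i = (of_bool (i \<noteq> 0 \<and> x \<in> A i) :: real)" for x i
  define v where "v y i = (of_bool (i \<noteq> 0 \<and> y \<in> B i) :: real)" for y i
  have u: "u x i = of_bool (i \<noteq> 0 \<and> i = j)" if "x \<in> A j" "j \<in> {0..k}" "i < Suc k" for x i j
  proof -
    have "i \<in> {0..k}" using that by simp
    then have "x \<in> A i \<longleftrightarrow> i = j" using disj[OF _ that(2) _ that(1)] that(1) by metis
    then show ?thesis by (simp only: u_def)
  qed
  have v: "v y i = of_bool (i \<noteq> 0 \<and> i = j)" if "y \<in> B j" "j \<in> {0..k}" "i < Suc k" for y i j
  proof -
    have "i \<in> {0..k}" using that by simp
    then have "y \<in> B i \<longleftrightarrow> i = j" using disj'[OF _ that(2) _ that(1)] that(1) by metis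
    then show ?thesis by (simp only: v_def)
  qed
  have sum: "(\<Sum>i<Suc k. of_bool (i \<noteq> 0 \<and> i = j) * f i) = (if j = 0 then 0 else f j)"
    if "j \<in> {0..k}" for j and f :: "nat \<Rightarrow> real"
  proof -
    have "(\<Sum>i<Suc k. of_bool (i \<noteq> 0 \<and> i = j) * f i) = (\<Sum>i<Suc k. if i = j then (if j = 0 then 0 else f j) else 0)"
      by (intro sum.cong) auto
    then show ?thesis using that by (simp del: sum.lessThan_Suc)
  qed
  have "M $$ (x, y) = (\<Sum>i<Suc k. u x i * v y i)" if xy: "x < dim_row M" "y < dim_col M" for x y
  proof -
    obtain i j where i: "i \<in> {0..k}" "x \<in> A i" and j: "j \<in> {0..k}" "y \<in> B j"
      using exA exB xy by blast
    have "(\<Sum>l<Suc k. u x l * v y l) = (\<Sum>l<Suc k. of_bool (l \<noteq> 0 \<and> l = i) * of_bool (l \<noteq> 0 \<and> l = j))"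
      by (intro sum.cong refl) (simp add: u[OF i(2,1)] v[OF j(2,1)])
    also have "\<dots> = of_bool (i = j \<and> i \<noteq> 0)" unfolding sum[OF i(1)] by simp
    also have "\<dots> = M $$ (x, y)"
    proof (cases "i = j \<and> i \<noteq> 0")
      case True
      then show ?thesis using D(6)[of i x y] i j by simp
    next
      case False
      then have "i \<noteq> j \<or> (i = 0 \<and> j = 0)" by blast
      then have "M $$ (x, y) = 0" using D(7)[OF i(1) j(1) _ i(2) j(2)] by blast
      then show ?thesis using False by simp
    qed
    finally show ?thesis by simp
  qed
  moreover have "(\<Sum>i<Suc k. (u x i)\<^sup>2) \<le> 1" if x: "x < dim_row M" for x
  proof -
    obtain i where i: "i \<in> {0..k}" "x \<in> A i" using exA x by blast
    have "(\<Sum>l<Suc k. (u x l)\<^sup>2) = (\<Sum>l<Suc k. of_bool (l \<noteq> 0 \<and> l = i) * 1)"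
      by (intro sum.cong refl) (auto simp: u[OF i(2,1)])
    then show ?thesis unfolding sum[OF i(1)] by simp
  qed
  moreover have "(\<Sum>i<Suc k. (v y i)\<^sup>2) \<le> 1" if y: "y < dim_col M" for y
  proof -
    obtain j where j: "j \<in> {0..k}" "y \<in> B j" using exB y by blast
    have "(\<Sum>l<Suc k. (v y l)\<^sup>2) = (\<Sum>l<Suc k. of_bool (l \<noteq> 0 \<and> l = j) * 1)"
      by (intro sum.cong refl) (auto simp: v[OF j(2,1)])
    then show ?thesis unfolding sum[OF j(1)] by simp
  qed
  ultimately show ?thesis
    unfolding inner_factored_def by (intro exI[of _ "Suc k"] exI[of _ u] exI[of _ v] conjI ballI)
      (simp_all del: sum.lessThan_Suc)
qed

text \<open>Concatenation adds squared norms, so both factors have norm at most the square root of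
  \<open>length Bs\<close>, and the product of the two norms is at most
  \<open>length Bs\<close>.\<close>

lemma gamma2_sum_thin_blocky_le:
  assumes "\<And>B. B \<in> set Bs \<Longrightarrow> B \<in> carrier_mat (dim_row M) (dim_col M) \<and> thin_blocky B"
    and M: "M = foldr (+) Bs (0\<^sub>m (dim_row M) (dim_col M))"
  shows "gamma2 M \<le> length Bs"
proof -
  have "inner_factored {..<dim_row M} {..<dim_col M} (\<lambda>x y. \<Sum>B\<leftarrow>Bs. B $$ (x, y))
      (real (length Bs)) (real (length Bs))"
    using assms(1)
  proof (induction Bs)
    case Nil
    then show ?case by (simp add: inner_factored_zero)
  next
    case (Cons B Bs)
    then have "B \<in> carrier_mat (dim_row M) (dim_col M)" "thin_blocky B" by auto
    then have "inner_factored {..<dim_row M} {..<dim_col M} (\<lambda>x y. B $$ (x, y)) 1 1"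
      unfolding thin_blocky_def using inner_factored_blocky_partition[of B] by auto
    from inner_factored_plus[OF this Cons.IH] Cons.prems show ?case by simp
  qed
  moreover have "(\<Sum>B\<leftarrow>Bs. B $$ (x, y)) = M $$ (x, y)" if "x < dim_row M" "y < dim_col M" for x y
  proof -
    have "foldr (+) Bs (0\<^sub>m (dim_row M) (dim_col M)) $$ (x, y) = (\<Sum>B\<leftarrow>Bs. B $$ (x, y))"
      using assms(1) that by (intro foldr_plus_mat_index) blast+
    then show ?thesis unfolding M[symmetric] by simp
  qed
  ultimately have "inner_factored {..<dim_row M} {..<dim_col M} (\<lambda>x y. M $$ (x, y))
      (real (length Bs)) (real (length Bs))"
    by (subst inner_factored_cong[symmetric, of _ _ "\<lambda>x y. \<Sum>B\<leftarrow>Bs. B $$ (x, y)"]) auto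
  then show ?thesis by (rule gamma2_le) simp
qed

text \<open>\<open>d\<close> is chosen before \<open>M\<close> and depends only on \<open>t\<close>
  and \<gamma>, so it serves a whole family.\<close>

lemma degenerate_within_if_gamma2_le:
  assumes t: "t > 0"
  obtains d where "\<And>M. boolean_mat M \<Longrightarrow> \<not> contains_all_ones M t \<Longrightarrow> gamma2 M \<le> \<gamma> \<Longrightarrow> degenerate_within M d"
proof -
  \<comment> \<open>Extracting a factorization takes a bound strictly above \<gamma>, and the
    absolute value keeps the square of \<open>c\<close> positive for every real \<gamma>.\<close>
  define c where "c = \<bar>\<gamma>\<bar> + 1"
  have c: "c\<^sup>2 > 0" "\<gamma> < c" by (auto simp: c_def)
  obtain d :: nat where d: "\<And>(X :: nat set) (Y :: nat set) a \<alpha> \<beta>. finite X \<Longrightarrow> finite Y \<Longrightarrow> X \<noteq> {} \<or> Y \<noteq> {} \<Longrightarrow>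
       (\<And>x y. x \<in> X \<Longrightarrow> y \<in> Y \<Longrightarrow> a x y \<in> {0, 1 :: real}) \<Longrightarrow>
       inner_factored X Y a \<alpha> \<beta> \<Longrightarrow> \<alpha> > 0 \<Longrightarrow> \<beta> > 0 \<Longrightarrow> \<alpha> * \<beta> \<le> c\<^sup>2 \<Longrightarrow> \<not> has_all_ones t X Y a \<Longrightarrow>
       (\<exists>x\<in>X. (\<Sum>y\<in>Y. a x y) \<le> real d) \<or> (\<exists>y\<in>Y. (\<Sum>x\<in>X. a x y) \<le> real d)"
    by (rule low_degree_vertex[OF c(1) t]) blast
  show ?thesis
  proof (rule that[of d])
    fix M assume M: "boolean_mat M" "\<not> contains_all_ones M t" "gamma2 M \<le> \<gamma>"
    let ?a = "\<lambda>x y. M $$ (x, y)"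
    obtain \<alpha> \<beta> where \<alpha>\<beta>: "\<alpha> > 0" "\<beta> > 0" "\<alpha> * \<beta> \<le> c\<^sup>2"
      "inner_factored {..<dim_row M} {..<dim_col M} ?a \<alpha> \<beta>"
      using inner_factored_if_gamma2_less[of M c] M(3) c(2) by (metis le_less_trans)
    show "degenerate_within M d"
      unfolding degenerate_within_iff
    proof (intro allI impI)
      fix X Y assume XY: "X \<subseteq> {..<dim_row M}" "Y \<subseteq> {..<dim_col M}" "X \<noteq> {} \<or> Y \<noteq> {}"
      have fin: "finite X" "finite Y" using XY(1,2) finite_subset by blast+
      have a01: "?a x y \<in> {0, 1}" if "x \<in> X" "y \<in> Y" for x y
        using boolean_mat_index[OF M(1)] that XY(1,2) by blast
      have no: "\<not> has_all_ones t X Y ?a"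
        using M(2) has_all_ones_imp_contains_all_ones has_all_ones_mono XY(1,2) by blast
      have "(\<Sum>y\<in>Y. ?a x y) = card {y \<in> Y. ?a x y = 1}" if "x \<in> X" for x
      proof -
        have "(\<Sum>y\<in>Y. ?a x y) = (\<Sum>y\<in>{y \<in> Y. ?a x y = 1}. 1)"
          using fin a01[OF that] by (intro sum.mono_neutral_cong_right) auto
        then show ?thesis by simp
      qed
      moreover have "(\<Sum>x\<in>X. ?a x y) = card {x \<in> X. ?a x y = 1}" if "y \<in> Y" for y
      proof -
        have "(\<Sum>x\<in>X. ?a x y) = (\<Sum>x\<in>{x \<in> X. ?a x y = 1}. 1)"
          using fin a01[OF _ that] by (intro sum.mono_neutral_cong_right) auto
        then show ?thesis by simp
      qed
      ultimately show "(\<exists>x\<in>X. card {y \<in> Y. ?a x y = 1} \<le> d) \<or> (\<exists>y\<in>Y. card {x \<in> X. ?a x y = 1} \<le> d)"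
        using d[OF fin XY(3) a01 inner_factored_mono[OF \<alpha>\<beta>(4) XY(1,2)] \<alpha>\<beta>(1-3) no] by force
    qed
  qed
qed

theorem corollary1p3:
  fixes t :: nat and \<M> :: "real mat set"
  assumes "t > 0"
    and "\<And>M. M \<in> \<M> \<Longrightarrow> boolean_mat M"
    and "\<And>M. M \<in> \<M> \<Longrightarrow> \<not> contains_all_ones M t"
  shows "((\<exists>\<gamma>::real. \<forall>M\<in>\<M>. gamma2 M \<le> \<gamma>) \<longleftrightarrow>
          (\<exists>b::nat. \<forall>M\<in>\<M>. \<exists>Bs. length Bs \<le> b \<and>
             (\<forall>B\<in>set Bs. B \<in> carrier_mat (dim_row M) (dim_col M) \<and> thin_blocky B) \<and>
             M = foldr (+) Bs (0\<^sub>m (dim_row M) (dim_col M))))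
       \<and> ((\<exists>b::nat. \<forall>M\<in>\<M>. \<exists>Bs. length Bs \<le> b \<and>
             (\<forall>B\<in>set Bs. B \<in> carrier_mat (dim_row M) (dim_col M) \<and> thin_blocky B) \<and>
             M = foldr (+) Bs (0\<^sub>m (dim_row M) (dim_col M))) \<longleftrightarrow>
          (\<exists>d::nat. \<forall>M\<in>\<M>. degeneracy M \<le> d))"
    (is "(?gamma \<longleftrightarrow> ?blocky) \<and> (?blocky \<longleftrightarrow> ?degeneracy)")
proof -
  \<comment> \<open>Both equivalences follow from a cycle of implications: from
    \<open>gamma2\<close> to degeneracy, to thin blocky sums, and back to
    \<open>gamma2\<close>.\<close>
  have "?degeneracy" if gamma: ?gamma
  proof -
    obtain \<gamma> where \<gamma>: "\<forall>M\<in>\<M>. gamma2 M \<le> \<gamma>" using gamma by blast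
    obtain d where "\<And>M. boolean_mat M \<Longrightarrow> \<not> contains_all_ones M t \<Longrightarrow> gamma2 M \<le> \<gamma> \<Longrightarrow> degenerate_within M d"
      using degenerate_within_if_gamma2_le[OF assms(1)] by blast
    then show ?thesis using assms(2,3) \<gamma> unfolding degeneracy_le_iff by blast
  qed
  moreover have "?blocky" if degeneracy: ?degeneracy
  proof -
    obtain d where "\<forall>M\<in>\<M>. degenerate_within M d" using degeneracy unfolding degeneracy_le_iff by blast
    then show ?thesis
      using assms(2) by (intro exI[of _ "2 * d"] ballI thin_blocky_sum_if_degenerate_within) auto
  qed
  moreover have "?gamma" if blocky: ?blocky
  proof -
    obtain b :: nat where b: "\<forall>M\<in>\<M>. \<exists>Bs. length Bs \<le> b \<and>
        (\<forall>B\<in>set Bs. B \<in> carrier_mat (dim_row M) (dim_col M) \<and> thin_blocky B) \<and>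
        M = foldr (+) Bs (0\<^sub>m (dim_row M) (dim_col M))" using blocky by blast
    have "gamma2 M \<le> b" if M: "M \<in> \<M>" for M
    proof -
      obtain Bs where Bs: "length Bs \<le> b"
        "\<forall>B\<in>set Bs. B \<in> carrier_mat (dim_row M) (dim_col M) \<and> thin_blocky B"
        "M = foldr (+) Bs (0\<^sub>m (dim_row M) (dim_col M))" using b M by blast
      have "gamma2 M \<le> length Bs" by (rule gamma2_sum_thin_blocky_le[OF _ Bs(3)]) (use Bs(2) in blast)
      then show ?thesis using Bs(1) by linarith
    qed
    then show ?thesis by blast
  qed
  ultimately show ?thesis by blast
qed

end
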